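(* Let $\sigma_n$ be chosen by the discrepancy principle, i.e. such that $C_1\delta\le\|Ax_n^\delta-y^\delta\|\le C_2\delta$ with constants $1\le C_1\le C_2$. Assume that there is a constant $m>0$ with $m\|\varrho(G)x\|\le\|Ax\|$ for all $x\in X$, that $x^\dagger-x_0=G^pv$ with $v\in X$, $\|v\|\le E$, for some positive constants $p,E$, and that $0\le s\le p$. If $f(t):=\psi_s^2\big(t^{1/(2p-2s)}\big)$ is convex and $\xi_s(t):=\psi_s^2(t^{1/(2s)})$ is convex, then $$\|x_n^\delta-x^\dagger\|\le E\Big[\psi_p^{-1}\Big(\frac{(C_2+1)\delta}{mE}\Big)\Big]^p .$$
   Context: Setting. $X,Y$ are Hilbert spaces; $A\in\mathcal L(X,Y)$ is linear, injective and bounded with non-closed range; $y\in\mathcal R(A)$, $x^\dagger\in X$ is the unique solution of $Ax=y$, and $y^\delta\in Y$ satisfies $\|y-y^\delta\|\le\delta$; $x_0\in X$ is a starting value. $B:\mathcal D(B)\subset X\to X$ is an unbounded densely defined self-adjoint strictly positive definite operator, $G:=B^{-1}$ (bounded, linear, injective, self-adjoint, with non-closed range), $a:=\|G\|$. Method. $T:=AG^s$, $\alpha_1,\dots,\alpha_n>0$, $\sigma_n:=\sum_{k=1}^n1/\alpha_k$ (the regularization parameter), and $$x_n^\delta:=x_0+G^sg_n(T^*T)T^*(y^\delta-Ax_0),\qquad g_n(\lambda)=\frac1\lambda\Big(1-\prod_{k=1}^n\frac{\alpha_k}{\lambda+\alpha_k}\Big).$$ Functions. An index function is a continuous, strictly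 increasing function $(0,a]\to(0,b]$ with limit $0$ at $0+$. $\varrho:(0,a]\to(0,b]$ is an index function with $a=\|G\|$, $b=\varrho(a)$. $\psi_r(\lambda):=\lambda^r\varrho(\lambda)$, $\psi_r:(0,a]\to(0,a^r\varrho(a)]$, for constants $r$ for which $\lambda^r\varrho(\lambda)$ is monotonically increasing. *)

theory Defs
  imports "HOL-Analysis.Analysis" "HOL-Computational_Algebra.Polynomial"
begin

section \<open>Unbounded operators, given by a domain \<open>D\<close> and a function used only on \<open>D\<close>\<close>

definition linear_operator_on :: "'x::real_inner set \<Rightarrow> ('x \<Rightarrow> 'x) \<Rightarrow> bool" where
  "linear_operator_on D B \<longleftrightarrow> subspace D \<and>
     (\<forall>x\<in>D. \<forall>y\<in>D. B (x + y) = B x + B y) \<and> (\<forall>c. \<forall>x\<in>D. B (c *\<^sub>R x) = c *\<^sub>R B x)"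

definition densely_defined :: "'x::real_inner set \<Rightarrow> bool" where
  "densely_defined D \<longleftrightarrow> closure D = UNIV"

(* For a dense domain D this set is the graph of the Hilbert space adjoint of B. *)
definition adjoint_graph :: "'x::real_inner set \<Rightarrow> ('x \<Rightarrow> 'x) \<Rightarrow> ('x \<times> 'x) set" where
  "adjoint_graph D B = {(y, z). \<forall>x\<in>D. B x \<bullet> y = x \<bullet> z}"

(* Equality of graphs, i.e. B and its adjoint also have the same domain. *)
definition self_adjoint_on :: "'x::real_inner set \<Rightarrow> ('x \<Rightarrow> 'x) \<Rightarrow> bool" where
  "self_adjoint_on D B \<longleftrightarrow> adjoint_graph D B = {(x, B x) | x. x \<in> D}"

definition strictly_positive_on :: "'x::real_inner set \<Rightarrow> ('x \<Rightarrow> 'x) \<Rightarrow> bool" where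
  "strictly_positive_on D B \<longleftrightarrow> (\<exists>\<gamma>>0. \<forall>x\<in>D. B x \<bullet> x \<ge> \<gamma> * (norm x)\<^sup>2)"

definition unbounded_on :: "'x::real_inner set \<Rightarrow> ('x \<Rightarrow> 'x) \<Rightarrow> bool" where
  "unbounded_on D B \<longleftrightarrow> \<not> (\<exists>K. \<forall>x\<in>D. norm (B x) \<le> K * norm x)"


section \<open>Functional calculus\<close>

definition adj :: "('x::real_inner \<Rightarrow>\<^sub>L 'y::real_inner) \<Rightarrow> 'y \<Rightarrow>\<^sub>L 'x" where
  "adj T = Blinfun (adjoint (blinfun_apply T))"

definition poly_op :: "real poly \<Rightarrow> ('x::real_normed_vector \<Rightarrow>\<^sub>L 'x) \<Rightarrow> 'x \<Rightarrow>\<^sub>L 'x" where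
  "poly_op P S = (\<Sum>i\<le>degree P. coeff P i *\<^sub>R ((\<lambda>F. S o\<^sub>L F) ^^ i) id_blinfun)"

(* Continuous functional calculus of a nonzero bounded self-adjoint operator S \<ge> 0, whose
   spectrum lies in [0, \<parallel>S\<parallel>]: the operator norm limit of P\<^sub>k(S) for any polynomials P\<^sub>k that
   converge to \<phi> uniformly.  Uniform convergence on (0, \<parallel>S\<parallel>] is the same as uniform
   convergence on [0, \<parallel>S\<parallel>] to the continuous extension of \<phi>.  Hence \<phi> needs to be continuous
   on (0, \<parallel>S\<parallel>] with a limit at 0+, and its formal value at 0 (such as 0 powr 0 = 0, or a
   division by 0) plays no role. *)
definition op_fun :: "(real \<Rightarrow> real) \<Rightarrow> ('x::real_normed_vector \<Rightarrow>\<^sub>L 'x) \<Rightarrow> 'x \<Rightarrow>\<^sub>L 'x" where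
  "op_fun \<phi> S = (THE F. \<forall>P :: nat \<Rightarrow> real poly.
     uniform_limit {0<..norm S} (\<lambda>k. poly (P k)) \<phi> sequentially \<longrightarrow>
     (\<lambda>k. poly_op (P k) S) \<longlonglongrightarrow> F)"

definition op_power :: "('x::real_normed_vector \<Rightarrow>\<^sub>L 'x) \<Rightarrow> real \<Rightarrow> 'x \<Rightarrow>\<^sub>L 'x" where
  "op_power S r = op_fun (\<lambda>t. t powr r) S"


section \<open>Nonstationary iterated Tikhonov regularization in Hilbert scales\<close>

definition g_filter :: "(nat \<Rightarrow> real) \<Rightarrow> nat \<Rightarrow> real \<Rightarrow> real" where
  "g_filter \<alpha> n t = 1 / t * (1 - (\<Prod>k=1..n. \<alpha> k / (t + \<alpha> k)))"

definition iterate ::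
  "('x::real_inner \<Rightarrow>\<^sub>L 'y::real_inner) \<Rightarrow> ('x \<Rightarrow>\<^sub>L 'x) \<Rightarrow> real \<Rightarrow> (nat \<Rightarrow> real) \<Rightarrow> 'x \<Rightarrow> 'y \<Rightarrow> nat \<Rightarrow> 'x"
  where
  "iterate A G s \<alpha> x\<^sub>0 y\<^sub>\<delta> n =
     (let T = A o\<^sub>L op_power G s in
      x\<^sub>0 + op_power G s (op_fun (g_filter \<alpha> n) (adj T o\<^sub>L T) (adj T (y\<^sub>\<delta> - A x\<^sub>0))))"


section \<open>Index functions\<close>

definition index_function :: "real \<Rightarrow> real \<Rightarrow> (real \<Rightarrow> real) \<Rightarrow> bool" where
  "index_function a b \<phi> \<longleftrightarrow> \<phi> ` {0<..a} \<subseteq> {0<..b} \<and> continuous_on {0<..a} \<phi> \<and>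
     strict_mono_on {0<..a} \<phi> \<and> (\<phi> \<longlongrightarrow> 0) (at_right 0)"

definition psi :: "(real \<Rightarrow> real) \<Rightarrow> real \<Rightarrow> real \<Rightarrow> real" where
  "psi \<rho> r t = t powr r * \<rho> t"

(* The inverse of the index function \<phi> : (0, a] \<rightarrow> (0, \<phi> a].  Outside (0, \<phi> a], where the inverse
   is not defined, it is continued by the constants 0 (on the left) and a (on the right). *)
definition index_inv :: "real \<Rightarrow> (real \<Rightarrow> real) \<Rightarrow> real \<Rightarrow> real" where
  "index_inv a \<phi> t =
     (if t \<le> 0 then 0 else if t \<le> \<phi> a then the_inv_into {0<..a} \<phi> t else a)"

end

theory Submission
  imports Defs
begin

text \<open>
  Write \<open>T = A G\<^sup>s\<close> and \<open>S = T\<^sup>*T\<close>, let \<open>z = G\<^bsup>p-s\<^esup>v\<close> be the preimage of the exact solution, and let \<open>h\<close>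
  be the error of the iterate before \<open>G\<^sup>s\<close> is applied, so that the error is \<open>G\<^sup>s h\<close>.  For \<open>n > 1\<close> there is no
  reason why \<open>\<parallel>h\<parallel>\<^sup>2 \<le> -\<langle>z, h\<rangle>\<close> should hold as it does for ordinary Tikhonov regularization.
  Instead, \<open>h\<close> is damped: with \<open>\<Pi>(t) = \<Prod> (1 + t/\<alpha>\<^sub>k)\<close>, \<open>\<kappa>(t) = t / (\<Pi>(t) - 1)\<close> and \<open>w = -\<sigma>\<^sub>n \<kappa>(S) h\<close>
  one has \<open>\<kappa>(S)(z + h) = T\<^sup>*(residual)\<close>, and the discrepancy principle together with
  \<open>2(\<Pi> - 1) \<le> \<sigma>\<^sub>n t (\<Pi> + 1)\<close> gives \<open>\<parallel>h\<parallel>\<^sup>2 \<le> \<langle>z, w\<rangle> \<le> E \<parallel>G\<^bsup>p-s\<^esup>w\<parallel>\<close>, while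
  \<open>\<sigma>\<^sub>n t \<le> \<Pi> - 1\<close> gives \<open>\<parallel>w\<parallel> \<le> \<parallel>h\<parallel>\<close> and \<open>\<parallel>Tw\<parallel> \<le> \<parallel>Th\<parallel> \<le> (C\<^sub>2 + 1)\<delta>\<close>.
  Supporting lines of the two convex functions at the point \<open>K = \<psi>\<^sub>p\<^sup>-\<^sup>1((C\<^sub>2 + 1)\<delta>/(mE))\<close>, carried over
  to operators by the positivity of the functional calculus, then give first \<open>\<parallel>h\<parallel> \<le> E K\<^bsup>p-s\<^esup>\<close> and
  then \<open>\<parallel>G\<^sup>s h\<parallel> \<le> E K\<^sup>p\<close>.
\<close>

section \<open>Projections and adjoints in Hilbert spaces\<close>

text \<open>A minimising sequence for the distance from \<open>x\<close> to \<open>M\<close> is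
  Cauchy by the parallelogram law, and minimality of its limit along each direction \<open>y\<close>
  gives orthogonality.\<close>

lemma orthogonal_projection_exists:
  fixes M :: "'a::{real_inner,banach} set"
  assumes "subspace M" and "closed M"
  shows "\<exists>p\<in>M. \<forall>y\<in>M. (x - p) \<bullet> y = 0"
proof -
  define D where "D = (INF y\<in>M. (norm (x - y))\<^sup>2)"
  have M0: "0 \<in> M" using assms(1) by (rule subspace_0)
  have bdd: "bdd_below ((\<lambda>y. (norm (x - y))\<^sup>2) ` M)" by (rule bdd_belowI[of _ 0]) auto
  have D_le: "D \<le> (norm (x - y))\<^sup>2" if "y \<in> M" for y
    unfolding D_def using bdd that by (rule cINF_lower)
  have "\<exists>y\<in>M. (norm (x - y))\<^sup>2 < D + 1 / real (Suc k)" for k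
    using cInf_lessD[of "(\<lambda>y. (norm (x - y))\<^sup>2) ` M" "D + 1 / real (Suc k)"] M0
    unfolding D_def by auto
  then obtain P where PM: "\<And>k. P k \<in> M"
    and P: "\<And>k. (norm (x - P k))\<^sup>2 < D + 1 / real (Suc k)" by metis
  have dist_P: "(norm (P k - P l))\<^sup>2 \<le> 2 / real (Suc k) + 2 / real (Suc l)" for k l
  proof -
    have "(1/2) *\<^sub>R (P k + P l) \<in> M" using PM assms(1) by (meson subspace_add subspace_scale)
    then have "D \<le> (norm (x - (1/2) *\<^sub>R (P k + P l)))\<^sup>2" by (rule D_le)
    moreover have "(norm (P k - P l))\<^sup>2 + 4 * (norm (x - (1/2) *\<^sub>R (P k + P l)))\<^sup>2 =
        2 * (norm (x - P k))\<^sup>2 + 2 * (norm (x - P l))\<^sup>2"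
      unfolding power2_norm_eq_inner
      by (simp add: inner_diff_left inner_diff_right inner_add_left inner_add_right inner_commute
          algebra_simps)
    ultimately show ?thesis using P[of k] P[of l] by linarith
  qed
  have "Cauchy P"
  proof (rule metric_CauchyI)
    fix e :: real assume e: "0 < e"
    obtain N where N: "4 / e\<^sup>2 < real N" using reals_Archimedean2 by blast
    show "\<exists>N. \<forall>k\<ge>N. \<forall>l\<ge>N. dist (P k) (P l) < e"
    proof (intro exI allI impI)
      fix k l assume kl: "N \<le> k" "N \<le> l"
      have N0: "real N > 0" using N e by (smt (verit) divide_pos_pos zero_less_power)
      have "2 / real (Suc k) \<le> 2 / real N" "2 / real (Suc l) \<le> 2 / real N"
        using kl N0 by (auto intro!: divide_left_mono)
      then have "(norm (P k - P l))\<^sup>2 \<le> 4 / real N" using dist_P[of k l] by linarith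
      also have "\<dots> < e\<^sup>2" using N N0 e by (simp add: field_simps)
      finally show "dist (P k) (P l) < e"
        using e by (simp add: dist_norm power_less_imp_less_base)
    qed
  qed
  then obtain p where p: "P \<longlonglongrightarrow> p" using Cauchy_convergent_iff convergent_def by blast
  have pM: "p \<in> M" using assms(2) PM p by (meson closed_sequentially)
  have "(norm (x - p))\<^sup>2 \<le> D + 0"
  proof (rule LIMSEQ_le)
    show "(\<lambda>k. (norm (x - P k))\<^sup>2) \<longlonglongrightarrow> (norm (x - p))\<^sup>2" by (intro tendsto_intros p)
    show "(\<lambda>k. D + 1 / real (Suc k)) \<longlonglongrightarrow> D + 0"
      using LIMSEQ_inverse_real_of_nat by (intro tendsto_intros) (simp add: inverse_eq_divide)
    show "\<exists>N. \<forall>n\<ge>N. (norm (x - P n))\<^sup>2 \<le> D + 1 / real (Suc n)" using P less_imp_le by blast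
  qed
  then have min: "(norm (x - p))\<^sup>2 \<le> (norm (x - y))\<^sup>2" if "y \<in> M" for y
    using D_le[OF that] by linarith
  have "(x - p) \<bullet> y = 0" if y: "y \<in> M" for y
  proof (cases "y = 0")
    case False
    \<comment> \<open>This \<open>t\<close> minimises the norm of
      \<open>(x - p) - t *\<^sub>R y\<close>; its square would drop by
      \<open>((x - p) \<bullet> y)^2 / (y \<bullet> y)\<close>.\<close>
    define t where "t = ((x - p) \<bullet> y) / (y \<bullet> y)"
    have yy: "y \<bullet> y > 0" using False by simp
    have "p + t *\<^sub>R y \<in> M" using pM y assms(1) by (meson subspace_add subspace_scale)
    then have "(norm (x - p))\<^sup>2 \<le> (norm ((x - p) - t *\<^sub>R y))\<^sup>2"
      using min by (simp add: diff_diff_eq)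
    also have "\<dots> = (norm (x - p))\<^sup>2 - 2 * t * ((x - p) \<bullet> y) + t * t * (y \<bullet> y)"
      unfolding power2_norm_eq_inner
      by (simp only: inner_diff_left[of "x - p" "t *\<^sub>R y"] inner_diff_right[of _ "x - p" "t *\<^sub>R y"])
         (simp add: inner_commute algebra_simps)
    also have "\<dots> = (norm (x - p))\<^sup>2 - ((x - p) \<bullet> y)\<^sup>2 / (y \<bullet> y)"
      using yy unfolding t_def by (simp add: field_simps power2_eq_square)
    finally have "((x - p) \<bullet> y)\<^sup>2 / (y \<bullet> y) \<le> 0" by linarith
    then show ?thesis using yy by (simp add: divide_le_0_iff)
  qed simp
  then show ?thesis using pM by blast
qed

text \<open>A vector \<open>e\<close> orthogonal to the closed kernel with
  \<open>f e \<noteq> 0\<close> represents \<open>f\<close> up to scale, because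
  \<open>f e *\<^sub>R x - f x *\<^sub>R e\<close> lies in the kernel.\<close>

lemma Riesz_representation:
  fixes f :: "'a::{real_inner,banach} \<Rightarrow> real"
  assumes "bounded_linear f"
  shows "\<exists>u. \<forall>x. f x = x \<bullet> u"
proof (cases "\<forall>x. f x = 0")
  case True
  then show ?thesis by (intro exI[of _ 0]) simp
next
  case False
  interpret f: bounded_linear f by fact
  from False obtain x0 where x0: "f x0 \<noteq> 0" by blast
  define M where "M = {x. f x = 0}"
  have "subspace M" by (simp add: M_def subspace_def f.add f.scaleR f.zero)
  moreover have "closed M"
    unfolding M_def by (intro closed_Collect_eq continuous_intros f.continuous_on)
  ultimately obtain p where p: "p \<in> M" "\<And>y. y \<in> M \<Longrightarrow> (x0 - p) \<bullet> y = 0"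
    using orthogonal_projection_exists by blast
  define e where "e = x0 - p"
  have fe: "f e \<noteq> 0" using x0 p(1) by (simp add: e_def M_def f.diff)
  then have ee: "e \<bullet> e \<noteq> 0" using f.zero by auto
  have "f x = x \<bullet> ((f e / (e \<bullet> e)) *\<^sub>R e)" for x
  proof -
    have "f e *\<^sub>R x - f x *\<^sub>R e \<in> M" by (simp add: M_def f.diff f.scaleR)
    then have "e \<bullet> (f e *\<^sub>R x - f x *\<^sub>R e) = 0" using p(2) by (simp add: e_def)
    then show ?thesis using ee by (simp add: inner_diff_right inner_commute field_simps)
  qed
  then show ?thesis by blast
qed

text \<open>\<open>adjoint\<close> is a choice and \<open>Blinfun\<close> is meaningful only for
  bounded maps, so an adjoint must first be shown to exist (by Riesz), to be unique and to be
  bounded.\<close>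

lemma inner_adj:
  fixes T :: "'a::{real_inner,banach} \<Rightarrow>\<^sub>L 'b::real_inner"
  shows "T x \<bullet> y = x \<bullet> adj T y"
proof -
  have "bounded_linear (\<lambda>x. T x \<bullet> y)" for y
    by (rule bounded_linear_compose[OF bounded_linear_inner_left blinfun.bounded_linear_right])
  then have "\<forall>y. \<exists>u. \<forall>x. T x \<bullet> y = x \<bullet> u" by (blast dest: Riesz_representation)
  then obtain g where g: "\<And>x y. T x \<bullet> y = x \<bullet> g y" by (auto dest!: choice)
  have ag: "adjoint (blinfun_apply T) = g" using g by (intro adjoint_unique) simp
  have "bounded_linear g"
  proof (rule bounded_linear_intro[where K = "norm T"])
    show "g (x + y) = g x + g y" for x y
    proof -
      have "z \<bullet> g (x + y) = z \<bullet> (g x + g y)" for z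
        unfolding inner_add_right g[symmetric] ..
      then show ?thesis using vector_eq_ldot by blast
    qed
    show "g (r *\<^sub>R x) = r *\<^sub>R g x" for r x
    proof -
      have "z \<bullet> g (r *\<^sub>R x) = z \<bullet> (r *\<^sub>R g x)" for z
        unfolding inner_scaleR_right g[symmetric] ..
      then show ?thesis using vector_eq_ldot by blast
    qed
    show "norm (g x) \<le> norm x * norm T" for x
    proof (cases "g x = 0")
      case False
      have "norm (g x) * norm (g x) = T (g x) \<bullet> x"
        by (simp add: g power2_norm_eq_inner flip: power2_eq_square)
      also have "\<dots> \<le> norm (T (g x)) * norm x" by (rule norm_cauchy_schwarz)
      also have "\<dots> \<le> norm T * norm (g x) * norm x" by (intro mult_right_mono norm_blinfun) simp
      finally have "norm (g x) * norm (g x) \<le> norm (g x) * (norm x * norm T)"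
        by (simp add: mult_ac)
      then show ?thesis using False by simp
    qed simp
  qed
  then show ?thesis using g ag by (simp add: adj_def bounded_linear_Blinfun_apply)
qed

section \<open>Functional calculus of a positive operator\<close>

lemma poly_op_sum_atMost:
  assumes "degree P \<le> N"
  shows "poly_op P S = (\<Sum>i\<le>N. coeff P i *\<^sub>R ((\<lambda>F. S o\<^sub>L F) ^^ i) id_blinfun)"
  unfolding poly_op_def
  by (rule sum.mono_neutral_left) (use assms in \<open>auto simp: coeff_eq_0\<close>)

lemma poly_op_0 [simp]: "poly_op 0 S = 0"
  by (simp add: poly_op_def)

lemma poly_op_pCons: "poly_op (pCons a P) S = a *\<^sub>R id_blinfun + (S o\<^sub>L poly_op P S)"
proof -
  have "poly_op (pCons a P) S =
      (\<Sum>i\<le>Suc (degree P). coeff (pCons a P) i *\<^sub>R ((\<lambda>F. S o\<^sub>L F) ^^ i) id_blinfun)"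
    by (rule poly_op_sum_atMost) (rule degree_pCons_le)
  also have "\<dots> = a *\<^sub>R id_blinfun +
      (\<Sum>i\<le>degree P. coeff P i *\<^sub>R (S o\<^sub>L ((\<lambda>F. S o\<^sub>L F) ^^ i) id_blinfun))"
    by (subst sum.atMost_Suc_shift) simp
  also have "(\<Sum>i\<le>degree P. coeff P i *\<^sub>R (S o\<^sub>L ((\<lambda>F. S o\<^sub>L F) ^^ i) id_blinfun)) = S o\<^sub>L poly_op P S"
    unfolding poly_op_def
    by (simp add: bounded_bilinear.sum_right[OF bounded_bilinear_blinfun_compose]
        bounded_bilinear.scaleR_right[OF bounded_bilinear_blinfun_compose])
  finally show ?thesis .
qed

lemma poly_op_add: "poly_op (P + Q) S = poly_op P S + poly_op Q S"
proof -
  define N where "N = max (degree P) (degree Q)"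
  have "degree (P + Q) \<le> N" "degree P \<le> N" "degree Q \<le> N"
    unfolding N_def by (auto intro: degree_add_le_max)
  then show ?thesis
    by (simp add: poly_op_sum_atMost[of _ N] sum.distrib scaleR_add_left)
qed

lemma poly_op_smult: "poly_op (smult a P) S = a *\<^sub>R poly_op P S"
  using poly_op_sum_atMost[OF degree_smult_le[of a P], of S]
  by (simp add: poly_op_def scaleR_sum_right)

lemma poly_op_diff: "poly_op (P - Q) S = poly_op P S - poly_op Q S"
  using poly_op_add[of P "smult (-1) Q" S] unfolding poly_op_smult by simp

lemma poly_op_const: "poly_op [:a:] S = a *\<^sub>R id_blinfun"
  by (simp add: poly_op_pCons)

lemma poly_op_X: "poly_op [:0, 1:] S = S"
  by (rule blinfun_eqI) (simp add: poly_op_pCons blinfun.bilinear_simps)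

lemma poly_op_mult: "poly_op (P * Q) S = poly_op P S o\<^sub>L poly_op Q S"
proof (induction P)
  case (pCons a P)
  show ?case
    by (rule blinfun_eqI)
       (simp add: mult_pCons_left poly_op_add poly_op_smult poly_op_pCons pCons blinfun.bilinear_simps)
qed simp

text \<open>
  The zero operator is excluded because every sequence of polynomials converges uniformly on
  \<open>{0<..0}\<close>, so that \<^const>\<open>op_fun\<close> is meaningless for it.
\<close>

definition positive_op :: "('x::real_inner \<Rightarrow>\<^sub>L 'x) \<Rightarrow> bool" where
  "positive_op S \<longleftrightarrow> (\<forall>x y. S x \<bullet> y = x \<bullet> S y) \<and> (\<forall>x. 0 \<le> S x \<bullet> x) \<and> S \<noteq> 0"

lemma positive_opD:
  assumes "positive_op S"
  shows "S x \<bullet> y = x \<bullet> S y" and "0 \<le> S x \<bullet> x" and "0 < norm S"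
  using assms by (auto simp: positive_op_def)

lemma poly_op_selfadjoint:
  assumes "positive_op S"
  shows "poly_op P S x \<bullet> y = x \<bullet> poly_op P S y"
proof (induction P arbitrary: x y)
  case (pCons a P)
  have "poly_op (pCons a P) S x \<bullet> y = a * (x \<bullet> y) + x \<bullet> poly_op P S (S y)"
    by (simp add: poly_op_pCons blinfun.bilinear_simps inner_add_left positive_opD[OF assms] pCons)
  \<comment> \<open>\<open>S\<close> commutes with its polynomials because multiplication of
    polynomials is commutative.\<close>
  also have "poly_op P S (S y) = S (poly_op P S y)"
    using arg_cong[OF mult.commute[of P "[:0, 1:]"], of "\<lambda>R. poly_op R S"]
    unfolding poly_op_mult poly_op_X by (metis blinfun_apply_blinfun_compose)
  finally show ?case
    by (simp add: poly_op_pCons blinfun.bilinear_simps inner_add_right)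
qed simp

text \<open>Continuity rules out a negative value at a single exceptional point \<open>z\<close>,
  since no point of \<open>{0..c}\<close> is isolated. This handles the zero of a cancelled factor
  and the endpoint 0 of half-open intervals.\<close>

lemma poly_nonneg_on_closure:
  assumes "0 < c" and "\<And>t. t \<in> {0..c} - {z} \<Longrightarrow> 0 \<le> poly Q t" and "t \<in> {0..c}"
  shows "0 \<le> poly Q (t :: real)"
proof (rule ccontr)
  assume neg: "\<not> 0 \<le> poly Q t"
  then have t: "t = z" using assms(2,3) by blast
  have "\<forall>\<^sub>F u in at t. poly Q u < 0"
    using neg poly_isCont[of t Q] by (intro order_tendstoD) (auto simp: isCont_def)
  then obtain d where d: "d > 0" "\<And>u. u \<noteq> t \<Longrightarrow> dist u t < d \<Longrightarrow> poly Q u < 0"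
    unfolding eventually_at by blast
  define e where "e = min (d / 2) (c / 2)"
  have e: "0 < e" "e < d" "e \<le> c / 2" using d assms(1) by (auto simp: e_def)
  have "t + e \<in> {0..c} \<or> t - e \<in> {0..c}" using e assms(1,3) by auto
  then show False
    using assms(2)[of "t + e"] assms(2)[of "t - e"] d(2)[of "t + e"] d(2)[of "t - e"] e t
    by (auto simp: dist_real_def)
qed

text \<open>If the minimum is attained at an endpoint, the linear factor has constant sign and the
  cofactor inherits it. At an interior minimiser the cofactor passes from nonpositive to nonnegative
  values, so it vanishes there too and the zero is double.\<close>

lemma poly_nonneg_decompose:
  fixes P :: "real poly"
  assumes c: "0 < c" and nn: "\<And>t. t \<in> {0..c} \<Longrightarrow> 0 \<le> poly P t" and deg: "0 < degree P"
  obtains m F Q where "0 \<le> m" and "P = [:m:] + F * Q" and "degree Q < degree P"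
    and "\<And>t. t \<in> {0..c} \<Longrightarrow> 0 \<le> poly Q t"
    and "F = [:0, 1:] \<or> F = [:c, -1:] \<or> (\<exists>t0. F = [:-t0, 1:] * [:-t0, 1:])"
proof -
  have "\<exists>t0\<in>{0..c}. \<forall>t\<in>{0..c}. poly P t0 \<le> poly P t"
    using c by (intro continuous_attains_inf continuous_intros) auto
  then obtain t0 where t0: "t0 \<in> {0..c}" and min: "\<And>t. t \<in> {0..c} \<Longrightarrow> poly P t0 \<le> poly P t"
    by blast
  define m where "m = poly P t0"
  have m: "0 \<le> m" using nn t0 by (simp add: m_def)
  have "poly (P - [:m:]) t0 = 0" by (simp add: m_def)
  then obtain R where R: "P - [:m:] = [:-t0, 1:] * R" unfolding poly_eq_0_iff_dvd by (rule dvdE)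
  have P: "P = [:m:] + [:-t0, 1:] * R" using R by (simp add: algebra_simps)
  have "R \<noteq> 0" using P deg by auto
  then have degX: "degree ([:-t0, 1:] * R) = Suc (degree R)" by (subst degree_mult_eq) simp_all
  have "degree ([:m:] + [:-t0, 1:] * R) = degree ([:-t0, 1:] * R)"
    by (rule degree_add_eq_right) (simp only: degX, simp)
  then have degR: "degree P = Suc (degree R)" unfolding P degX .
  have eval: "poly P t - m = (t - t0) * poly R t" for t
    using arg_cong[OF R, of "\<lambda>p. poly p t"] by (simp add: algebra_simps)
  have sgn: "0 \<le> (t - t0) * poly R t" if "t \<in> {0..c}" for t
    using min[OF that] eval[of t] by (simp add: m_def)
  consider "t0 = 0" | "t0 = c" | "t0 \<in> {0<..<c}" using t0 by force
  then show thesis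
  proof cases
    case 1
    have "0 \<le> poly R t" if "t \<in> {0..c}" for t
      by (rule poly_nonneg_on_closure[OF c _ that, where z = 0])
        (use sgn 1 in \<open>force simp: zero_le_mult_iff\<close>)
    then show thesis using that[of m "[:0, 1:]" R] m P degR 1 by simp
  next
    case 2
    have "0 \<le> poly (- R) t" if "t \<in> {0..c}" for t
      by (rule poly_nonneg_on_closure[OF c _ that, where z = c])
        (use sgn 2 in \<open>force simp: zero_le_mult_iff\<close>)
    moreover have "P = [:m:] + [:c, -1:] * (- R)" using P 2 by simp
    ultimately show thesis using degR by (intro that[OF m, of "[:c, -1:]" "- R"]) simp_all
  next
    case 3
    have Rpos: "0 \<le> poly R t" if "t \<in> {t0<..c}" for t
      using sgn[of t] that 3 by (auto simp: zero_le_mult_iff)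
    have Rneg: "poly R t \<le> 0" if "t \<in> {0..<t0}" for t
      using sgn[of t] that 3 by (auto simp: zero_le_mult_iff)
    \<comment> \<open>The substitutions \<open>t0 + u\<close> and \<open>t0 - u\<close> turn the
      one-sided sign conditions on \<open>R\<close> into statements at \<open>u = 0\<close>;
      together they force \<open>poly R t0 = 0\<close>.\<close>
    have "0 \<le> poly (pcompose R [:t0, 1:]) 0"
      by (rule poly_nonneg_on_closure[where c = "c - t0" and z = 0])
         (use 3 Rpos in \<open>auto simp: poly_pcompose add.commute\<close>)
    moreover have "0 \<le> poly (- pcompose R [:t0, -1:]) 0"
      by (rule poly_nonneg_on_closure[where c = t0 and z = 0])
         (use 3 Rneg in \<open>auto simp: poly_pcompose\<close>)
    ultimately have "poly R t0 = 0" by (simp add: poly_pcompose)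
    then obtain Q where Q: "R = [:-t0, 1:] * Q" unfolding poly_eq_0_iff_dvd by (rule dvdE)
    have "Q \<noteq> 0" using Q \<open>R \<noteq> 0\<close> by auto
    then have degQ: "degree R = Suc (degree Q)" unfolding Q by (subst degree_mult_eq) simp_all
    have "0 \<le> poly Q t" if "t \<in> {0..c}" for t
    proof (rule poly_nonneg_on_closure[OF c _ that, where z = t0])
      fix t assume t: "t \<in> {0..c} - {t0}"
      have "0 \<le> (t - t0)\<^sup>2 * poly Q t"
        using sgn[of t] t unfolding Q by (simp add: power2_eq_square algebra_simps)
      then show "0 \<le> poly Q t" using t by (simp add: zero_le_mult_iff)
    qed
    moreover have "P = [:m:] + ([:-t0, 1:] * [:-t0, 1:]) * Q"
      unfolding P Q by (simp only: mult.assoc)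
    ultimately show thesis using that[of m "[:-t0, 1:] * [:-t0, 1:]" Q] m degR degQ by auto
  qed
qed

text \<open>
  Induction on the degree: subtracting the minimum of \<open>P\<close> on \<open>[0, c]\<close> creates a zero there, hence a
  factor \<open>X\<close>, \<open>c - X\<close> or \<open>(X - t\<^sub>0)\<^sup>2\<close>.  Proving the claim simultaneously for the multiples of \<open>P\<close> by
  \<open>1\<close>, \<open>X\<close>, \<open>c - X\<close>, \<open>X (c - X)\<close> makes the induction close without square roots of operators.
\<close>

lemma poly_op_nonneg:
  assumes S: "positive_op S" and nn: "\<And>t. t \<in> {0<..norm S} \<Longrightarrow> 0 \<le> poly P t"
  shows "0 \<le> poly_op P S x \<bullet> x"
proof -
  define c where "c = norm S"
  define N where "N = (\<lambda>P. \<forall>x. 0 \<le> poly_op P S x \<bullet> x)"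
  define X Y where "X = [:0, 1 :: real:]" and "Y = [:c, -1:]"
  note pS = positive_opD[OF S]
  have c: "0 < c" using pS by (simp add: c_def)
  have N_add: "N (P + Q)" if "N P" "N Q" for P Q
    using that by (simp add: N_def poly_op_add blinfun.bilinear_simps inner_add_left)
  have N_smult: "N (smult a P)" if "N P" "0 \<le> a" for a P
    using that by (simp add: N_def poly_op_smult blinfun.bilinear_simps)
  \<comment> \<open>Self-adjointness moves one factor \<open>L\<close> to the other side, so the
    quadratic form of \<open>P\<close> is evaluated at \<open>poly_op L S x\<close>.\<close>
  have N_sq: "N (L * L * P)" if "N P" for L P
  proof -
    have "poly_op (L * L * P) S x \<bullet> x = poly_op P S (poly_op L S x) \<bullet> poly_op L S x" for x
    proof -
      have eq: "L * L * P = L * (P * L)" by (simp only: mult_ac)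
      show ?thesis unfolding eq poly_op_mult by (simp add: poly_op_selfadjoint[OF S, of L])
    qed
    then show ?thesis using that by (simp add: N_def)
  qed
  have N1: "N 1" by (simp add: N_def poly_op_const one_pCons)
  have NX: "N X" by (simp add: N_def X_def poly_op_X pS(2))
  have NY: "N Y"
    unfolding N_def
  proof
    fix x
    have "S x \<bullet> x \<le> norm (S x) * norm x" by (rule norm_cauchy_schwarz)
    also have "\<dots> \<le> (c * norm x) * norm x" unfolding c_def by (intro mult_right_mono norm_blinfun) simp
    finally have "S x \<bullet> x \<le> c * (x \<bullet> x)" by (simp add: power2_norm_eq_inner[symmetric] power2_eq_square)
    moreover have "poly_op Y S x \<bullet> x = c * (x \<bullet> x) - S x \<bullet> x"
      by (simp add: Y_def poly_op_pCons blinfun.bilinear_simps inner_diff_left)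
    ultimately show "0 \<le> poly_op Y S x \<bullet> x" by simp
  qed
  \<comment> \<open>Since \<open>X + Y = c\<close>, the product \<open>X * Y\<close> is a positive
    multiple of a sum of squares times \<open>X\<close> or \<open>Y\<close>.\<close>
  have "smult (1 / c) (Y * Y * X + X * X * Y) = X * Y"
    using c by (simp add: X_def Y_def)
  then have NXY: "N (X * Y)"
    using N_smult[OF N_add[OF N_sq[OF NX, of Y] N_sq[OF NY, of X]], of "1 / c"] c by simp
  have main: "\<forall>W\<in>{1, X, Y, X * Y}. N (W * P)" if "\<And>t. t \<in> {0..c} \<Longrightarrow> 0 \<le> poly P t" for P
    using that
  proof (induction "degree P" arbitrary: P rule: less_induct)
    case less
    show ?case
    proof (cases "degree P = 0")
      case True
      then obtain m where P: "P = [:m:]" by (meson degree_eq_zeroE)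
      then have "0 \<le> m" using less.prems[of 0] c by simp
      then show ?thesis unfolding P using N1 NX NY NXY N_smult[OF N1, of m] by (auto intro: N_smult)
    next
      case False
      obtain m F Q where m: "0 \<le> m" and P: "P = [:m:] + F * Q" and deg: "degree Q < degree P"
        and Q: "\<And>t. t \<in> {0..c} \<Longrightarrow> 0 \<le> poly Q t"
        and F: "F = X \<or> F = Y \<or> (\<exists>t0. F = [:-t0, 1:] * [:-t0, 1:])"
        using poly_nonneg_decompose[OF c less.prems] False unfolding X_def Y_def by blast
      have NQ: "N (1 * Q)" "N (X * Q)" "N (Y * Q)" "N (X * Y * Q)"
        using less.hyps[OF deg Q] by blast+
      show ?thesis
      proof
        fix W assume W: "W \<in> {1, X, Y, X * Y}"
        have "N (W * (F * Q))"
          using F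
        proof (elim disjE exE)
          assume F: "F = X"
          \<comment> \<open>Each product with \<open>F\<close> either contains a square, which
            \<open>N_sq\<close> absorbs, or is \<open>X * Y * Q\<close> itself.\<close>
          have eqs: "X * (X * Q) = X * X * (1 * Q)" "Y * (X * Q) = X * Y * Q"
            "X * Y * (X * Q) = X * X * (Y * Q)" by (simp_all only: mult_ac mult_1)
          have "N (X * (X * Q))" "N (Y * (X * Q))" "N (X * Y * (X * Q))"
            unfolding eqs by (rule NQ N_sq)+
          then show ?thesis using W NQ F by auto
        next
          assume F: "F = Y"
          have eqs: "X * (Y * Q) = X * Y * Q" "Y * (Y * Q) = Y * Y * (1 * Q)"
            "X * Y * (Y * Q) = Y * Y * (X * Q)" by (simp_all only: mult_ac mult_1)
          have "N (X * (Y * Q))" "N (Y * (Y * Q))" "N (X * Y * (Y * Q))"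
            unfolding eqs by (rule NQ N_sq)+
          then show ?thesis using W NQ F by auto
        next
          fix t0 assume F: "F = [:-t0, 1:] * [:-t0, 1:]"
          have "W * (F * Q) = [:-t0, 1:] * [:-t0, 1:] * (W * Q)" unfolding F by (simp only: mult_ac)
          moreover have "N (W * Q)" using W NQ by auto
          ultimately show ?thesis using N_sq by metis
        qed
        moreover have "N (W * [:m:])" using W N1 NX NY NXY N_smult[OF N1 m] m by (auto intro: N_smult)
        ultimately show "N (W * P)" unfolding P distrib_left by (intro N_add)
      qed
    qed
  qed
  have "0 \<le> poly P t" if "t \<in> {0..c}" for t
    by (rule poly_nonneg_on_closure[OF c _ that, where z = 0])
      (use nn in \<open>auto simp: c_def\<close>)
  then show ?thesis using main[of P] by (simp add: N_def)
qed

text \<open>Positivity of \<open>M^2 - P^2\<close> as a quadratic form bounds the norm. This makes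
  the map from polynomials to operators continuous for uniform convergence.\<close>

lemma norm_poly_op_le:
  assumes S: "positive_op S" and le: "\<And>t. t \<in> {0<..norm S} \<Longrightarrow> \<bar>poly P t\<bar> \<le> M"
  shows "norm (poly_op P S) \<le> M"
proof -
  \<comment> \<open>The interval contains \<open>norm S\<close>, so the bound \<open>M\<close> is
    automatically nonnegative.\<close>
  have "0 \<le> \<bar>poly P (norm S)\<bar>" by simp
  also have "\<dots> \<le> M" using le[of "norm S"] positive_opD(3)[OF S] by simp
  finally have M: "0 \<le> M" .
  show ?thesis
  proof (rule norm_blinfun_bound[OF M])
    fix x
    have "0 \<le> poly_op ([:M\<^sup>2:] - P * P) S x \<bullet> x"
    proof (rule poly_op_nonneg[OF S])
      fix t assume "t \<in> {0<..norm S}"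
      then have "\<bar>poly P t\<bar>\<^sup>2 \<le> M\<^sup>2" using le by (intro power_mono) auto
      then show "0 \<le> poly ([:M\<^sup>2:] - P * P) t" by (simp add: power2_eq_square)
    qed
    then have "(norm (poly_op P S x))\<^sup>2 \<le> (M * norm x)\<^sup>2"
      by (simp add: poly_op_diff poly_op_mult poly_op_const blinfun.bilinear_simps inner_diff_left
          poly_op_selfadjoint[OF S, of _ "poly_op P S x"] power_mult_distrib power2_norm_eq_inner)
    then show "norm (poly_op P S x) \<le> M * norm x"
      using M by (meson power2_le_imp_le mult_nonneg_nonneg norm_ge_zero)
  qed
qed

text \<open>Agreement is required off 0 only, so that formal values such as \<open>0 powr 0\<close>
  or a quotient by 0 do not matter, in accordance with \<open>op_fun\<close>.\<close>

definition extendable :: "real \<Rightarrow> (real \<Rightarrow> real) \<Rightarrow> bool" where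
  "extendable c \<phi> \<longleftrightarrow> (\<exists>f. continuous_on {0..c} f \<and> (\<forall>t\<in>{0<..c}. \<phi> t = f t))"

lemma extendableI:
  assumes "continuous_on {0..c} f" and "\<And>t. 0 < t \<Longrightarrow> t \<le> c \<Longrightarrow> \<phi> t = f t"
  shows "extendable c \<phi>"
  using assms unfolding extendable_def by auto

lemma extendable_continuous: "continuous_on {0..c} \<phi> \<Longrightarrow> extendable c \<phi>"
  by (rule extendableI) auto

lemma extendable_limit:
  assumes "continuous_on {0<..c} \<phi>" and "(\<phi> \<longlongrightarrow> l) (at_right 0)"
  shows "extendable c \<phi>"
proof (rule extendableI)
  show "continuous_on {0..c} (\<lambda>t. if t = 0 then l else \<phi> t)"
    unfolding continuous_on_eq_continuous_within
  proof
    fix t assume t: "t \<in> {0..c}"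
    show "continuous (at t within {0..c}) (\<lambda>t. if t = 0 then l else \<phi> t)"
    proof (cases "t = 0")
      case True
      have "{0..c} - {0} = {0<..c} - {0}" by auto
      then have at_within: "at 0 within {0..c} = at 0 within {0<..c}" by (simp add: at_within_def)
      have "((\<lambda>t. if t = 0 then l else \<phi> t) \<longlongrightarrow> l) (at 0 within {0..c})"
      proof (rule Lim_transform_eventually)
        show "(\<phi> \<longlongrightarrow> l) (at 0 within {0..c})"
          unfolding at_within by (rule tendsto_within_subset[OF assms(2)]) auto
        show "\<forall>\<^sub>F x in at 0 within {0..c}. \<phi> x = (if x = 0 then l else \<phi> x)"
          by (simp add: eventually_at_filter)
      qed
      then show ?thesis using True by (simp add: continuous_within)
    next
      case False
      then have t0: "0 < t" using t by auto
      have "continuous (at t within {0<..c}) \<phi>"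
        using assms(1) t t0 by (auto simp: continuous_on_eq_continuous_within)
      then have "continuous (at t within {0<..c}) (\<lambda>t. if t = 0 then l else \<phi> t)"
        using t t0 by (elim continuous_transform_within[of _ _ _ t]) auto
      moreover have "at t within {0..c} = at t within {0<..c}"
        by (rule at_within_nhd[of t "{0<..}"]) (use t0 in auto)
      ultimately show ?thesis by simp
    qed
  qed
qed auto

lemma extendable_add: "extendable c \<phi> \<Longrightarrow> extendable c \<theta> \<Longrightarrow> extendable c (\<lambda>t. \<phi> t + \<theta> t)"
  unfolding extendable_def
  by (elim exE conjE, rule_tac x = "\<lambda>t. f t + fa t" in exI) (auto intro!: continuous_intros)

lemma extendable_mult: "extendable c \<phi> \<Longrightarrow> extendable c \<theta> \<Longrightarrow> extendable c (\<lambda>t. \<phi> t * \<theta> t)"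
  unfolding extendable_def
  by (elim exE conjE, rule_tac x = "\<lambda>t. f t * fa t" in exI) (auto intro!: continuous_intros)

lemma extendable_const: "extendable c (\<lambda>t. k)"
  by (intro extendable_continuous continuous_intros)

lemma extendable_id: "extendable c (\<lambda>t. t)"
  by (intro extendable_continuous continuous_intros)

lemma extendable_cmult: "extendable c \<phi> \<Longrightarrow> extendable c (\<lambda>t. k * \<phi> t)"
  by (intro extendable_mult extendable_const)

lemma extendable_diff: "extendable c \<phi> \<Longrightarrow> extendable c \<theta> \<Longrightarrow> extendable c (\<lambda>t. \<phi> t - \<theta> t)"
  unfolding extendable_def
  by (elim exE conjE, rule_tac x = "\<lambda>t. f t - fa t" in exI) (auto intro!: continuous_intros)

lemma extendable_bounded:
  assumes "extendable c \<phi>"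
  shows "bounded (\<phi> ` {0<..c})"
proof -
  obtain f where f: "continuous_on {0..c} f" "\<forall>t\<in>{0<..c}. \<phi> t = f t"
    using assms by (auto simp: extendable_def)
  have "bounded (f ` {0..c})" using f(1) by (intro compact_imp_bounded compact_continuous_image) auto
  moreover have "\<phi> ` {0<..c} \<subseteq> f ` {0..c}" using f(2) by auto
  ultimately show ?thesis by (rule bounded_subset)
qed

section \<open>Polynomial approximation and the continuous functional calculus\<close>

lemma real_polynomial_function_poly:
  fixes f :: "real \<Rightarrow> real"
  assumes "real_polynomial_function f"
  shows "\<exists>P. f = poly P"
  using assms
proof induction
  case (linear f)
  then obtain k where "f = (\<lambda>x. x * k)" unfolding real_bounded_linear ..
  then have "f = poly [:0, k:]" by (simp add: fun_eq_iff)
  then show ?case ..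
next
  case (const k)
  have "(\<lambda>x. k) = poly [:k:]" by auto
  then show ?case ..
next
  case (add f g)
  then obtain P Q where "f = poly P" "g = poly Q" by blast
  then have "(\<lambda>x. f x + g x) = poly (P + Q)" by (simp add: fun_eq_iff)
  then show ?case ..
next
  case (mult f g)
  then obtain P Q where "f = poly P" "g = poly Q" by blast
  then have "(\<lambda>x. f x * g x) = poly (P * Q)" by (simp add: fun_eq_iff)
  then show ?case ..
qed

text \<open>Stone-Weierstrass needs a compact interval, hence it is applied to the extension on
  \<open>{0..c}\<close>.\<close>

lemma extendable_poly_limit:
  assumes "extendable c \<phi>"
  obtains P where "uniform_limit {0<..c} (\<lambda>k. poly (P k)) \<phi> sequentially"
proof -
  obtain f where f: "continuous_on {0..c} f" "\<forall>t\<in>{0<..c}. \<phi> t = f t"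
    using assms by (auto simp: extendable_def)
  have "\<exists>P. \<forall>t\<in>{0..c}. \<bar>f t - poly P t\<bar> < 1 / real (Suc k)" for k
  proof -
    have "0 < 1 / real (Suc k)" by simp
    then obtain g where "real_polynomial_function g" "\<And>t. t \<in> {0..c} \<Longrightarrow> \<bar>f t - g t\<bar> < 1 / real (Suc k)"
      using Stone_Weierstrass_real_polynomial_function[OF compact_Icc f(1)] by blast
    then show ?thesis using real_polynomial_function_poly by blast
  qed
  then obtain P where P: "\<And>k t. t \<in> {0..c} \<Longrightarrow> \<bar>f t - poly (P k) t\<bar> < 1 / real (Suc k)" by metis
  have "uniform_limit {0<..c} (\<lambda>k. poly (P k)) \<phi> sequentially"
  proof (rule uniform_limitI)
    fix e :: real assume "0 < e"
    then obtain N where N: "1 / real (Suc N) < e" using nat_approx_posE by blast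
    show "\<forall>\<^sub>F k in sequentially. \<forall>t\<in>{0<..c}. dist (poly (P k) t) (\<phi> t) < e"
      unfolding eventually_sequentially
    proof (intro exI allI impI ballI)
      fix k t assume k: "N \<le> k" and t: "t \<in> {0<..c}"
      have "1 / real (Suc k) \<le> 1 / real (Suc N)" using k by (intro divide_left_mono) auto
      then show "dist (poly (P k) t) (\<phi> t) < e"
        using P[of t k] N t f(2) by (auto simp: dist_real_def abs_minus_commute)
    qed
  qed
  then show thesis by (rule that)
qed

text \<open>With \<open>P = Q\<close> this is the Cauchy property of the approximating operators;
  with different sequences it shows that their limit is independent of the choice.\<close>

lemma poly_op_close:
  assumes S: "positive_op S" and "0 < e"
    and P: "uniform_limit {0<..norm S} (\<lambda>k. poly (P k)) \<phi> sequentially"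
    and Q: "uniform_limit {0<..norm S} (\<lambda>k. poly (Q k)) \<phi> sequentially"
  shows "\<exists>N. \<forall>k\<ge>N. \<forall>l\<ge>N. norm (poly_op (P k) S - poly_op (Q l) S) \<le> e"
proof -
  have "0 < e / 2" using \<open>0 < e\<close> by simp
  obtain N1 where N1: "\<And>k t. k \<ge> N1 \<Longrightarrow> t \<in> {0<..norm S} \<Longrightarrow> dist (poly (P k) t) (\<phi> t) < e / 2"
    using uniform_limitD[OF P \<open>0 < e / 2\<close>] unfolding eventually_sequentially by blast
  obtain N2 where N2: "\<And>k t. k \<ge> N2 \<Longrightarrow> t \<in> {0<..norm S} \<Longrightarrow> dist (poly (Q k) t) (\<phi> t) < e / 2"
    using uniform_limitD[OF Q \<open>0 < e / 2\<close>] unfolding eventually_sequentially by blast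
  show ?thesis
  proof (intro exI allI impI)
    fix k l assume kl: "max N1 N2 \<le> k" "max N1 N2 \<le> l"
    have "norm (poly_op (P k - Q l) S) \<le> e"
    proof (rule norm_poly_op_le[OF S])
      fix t assume t: "t \<in> {0<..norm S}"
      show "\<bar>poly (P k - Q l) t\<bar> \<le> e"
        using N1[OF _ t, of k] N2[OF _ t, of l] kl unfolding dist_real_def poly_diff by linarith
    qed
    then show "norm (poly_op (P k) S - poly_op (Q l) S) \<le> e" by (simp add: poly_op_diff)
  qed
qed

text \<open>This justifies the definite description in \<open>op_fun\<close>: a limit exists by
  completeness and is common to all approximating sequences. Uniqueness comes from the given
  sequence \<open>P\<close>, as without any such sequence every operator would qualify.\<close>

lemma op_fun_tendsto:
  fixes S :: "'x::{real_inner,banach} \<Rightarrow>\<^sub>L 'x"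
  assumes S: "positive_op S"
    and P: "uniform_limit {0<..norm S} (\<lambda>k. poly (P k)) \<phi> sequentially"
  shows "(\<lambda>k. poly_op (P k) S) \<longlonglongrightarrow> op_fun \<phi> S"
proof -
  have "Cauchy (\<lambda>k. poly_op (P k) S)"
  proof (rule metric_CauchyI)
    fix e :: real assume "0 < e"
    then obtain N where "\<And>k l. k \<ge> N \<Longrightarrow> l \<ge> N \<Longrightarrow> norm (poly_op (P k) S - poly_op (P l) S) \<le> e / 2"
      using poly_op_close[OF S _ P P, of "e / 2"] by auto
    then show "\<exists>N. \<forall>k\<ge>N. \<forall>l\<ge>N. dist (poly_op (P k) S) (poly_op (P l) S) < e"
      unfolding dist_norm using \<open>0 < e\<close> by (intro exI[of _ N]) fastforce
  qed
  then obtain F where F: "(\<lambda>k. poly_op (P k) S) \<longlonglongrightarrow> F"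
    using Cauchy_convergent_iff convergent_def by blast
  have lim: "(\<lambda>k. poly_op (Q k) S) \<longlonglongrightarrow> F"
    if Q: "uniform_limit {0<..norm S} (\<lambda>k. poly (Q k)) \<phi> sequentially" for Q
  proof -
    have "(\<lambda>k. poly_op (P k) S - poly_op (Q k) S) \<longlonglongrightarrow> 0"
    proof (rule LIMSEQ_I)
      fix e :: real assume "0 < e"
      then obtain N where "\<And>k l. k \<ge> N \<Longrightarrow> l \<ge> N \<Longrightarrow> norm (poly_op (P k) S - poly_op (Q l) S) \<le> e / 2"
        using poly_op_close[OF S _ P Q, of "e / 2"] by auto
      then show "\<exists>N. \<forall>k\<ge>N. norm (poly_op (P k) S - poly_op (Q k) S - 0) < e"
        using \<open>0 < e\<close> by (intro exI[of _ N]) fastforce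
    qed
    from tendsto_diff[OF F this] show ?thesis by simp
  qed
  have "op_fun \<phi> S = F"
    unfolding op_fun_def
  proof (rule the_equality)
    fix F' assume "\<forall>P. uniform_limit {0<..norm S} (\<lambda>k. poly (P k)) \<phi> sequentially \<longrightarrow>
      (\<lambda>k. poly_op (P k) S) \<longlonglongrightarrow> F'"
    then show "F' = F" using P F LIMSEQ_unique by blast
  qed (use lim in blast)
  then show ?thesis using F by simp
qed

lemma op_fun_cong:
  assumes "\<And>t. t \<in> {0<..norm S} \<Longrightarrow> \<phi> t = \<theta> t"
  shows "op_fun \<phi> S = op_fun \<theta> S"
proof -
  have "uniform_limit {0<..norm S} f \<phi> F = uniform_limit {0<..norm S} f \<theta> F" for f and F :: "nat filter"
    using assms by (intro uniform_limit_cong') auto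
  then show ?thesis unfolding op_fun_def by simp
qed

context
  fixes S :: "'x::{real_inner,banach} \<Rightarrow>\<^sub>L 'x"
  assumes S: "positive_op S"
begin

lemma op_fun_poly: "op_fun (poly P) S = poly_op P S"
  by (rule LIMSEQ_unique[OF op_fun_tendsto[OF S, of "\<lambda>_. P"] tendsto_const])
     (rule uniform_limit_const)

lemma op_fun_const: "op_fun (\<lambda>t. k) S = k *\<^sub>R id_blinfun"
  using op_fun_poly[of "[:k:]"] op_fun_cong[of S "\<lambda>t. k" "poly [:k:]"] by (simp add: poly_op_const)

lemma op_fun_id: "op_fun (\<lambda>t. t) S = S"
  using op_fun_poly[of "[:0, 1:]"] op_fun_cong[of S "\<lambda>t. t" "poly [:0, 1:]"] by (simp add: poly_op_X)

lemma op_fun_add: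
  assumes "extendable (norm S) \<phi>" and "extendable (norm S) \<theta>"
  shows "op_fun (\<lambda>t. \<phi> t + \<theta> t) S = op_fun \<phi> S + op_fun \<theta> S"
proof -
  obtain P Q where PQ: "uniform_limit {0<..norm S} (\<lambda>k. poly (P k)) \<phi> sequentially"
    "uniform_limit {0<..norm S} (\<lambda>k. poly (Q k)) \<theta> sequentially"
    using assms extendable_poly_limit by metis
  have "(\<lambda>k. poly (P k + Q k)) = (\<lambda>k t. poly (P k) t + poly (Q k) t)" by (simp add: fun_eq_iff)
  then have "uniform_limit {0<..norm S} (\<lambda>k. poly (P k + Q k)) (\<lambda>t. \<phi> t + \<theta> t) sequentially"
    using uniform_limit_add[OF PQ] by simp
  from op_fun_tendsto[OF S this] show ?thesis
    unfolding poly_op_add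
    by (rule LIMSEQ_unique) (intro tendsto_add op_fun_tendsto[OF S] PQ)
qed

lemma op_fun_mult:
  assumes "extendable (norm S) \<phi>" and "extendable (norm S) \<theta>"
  shows "op_fun (\<lambda>t. \<phi> t * \<theta> t) S = op_fun \<phi> S o\<^sub>L op_fun \<theta> S"
proof -
  obtain P Q where PQ: "uniform_limit {0<..norm S} (\<lambda>k. poly (P k)) \<phi> sequentially"
    "uniform_limit {0<..norm S} (\<lambda>k. poly (Q k)) \<theta> sequentially"
    using assms extendable_poly_limit by metis
  \<comment> \<open>Uniform limits may be multiplied because both limit functions are bounded on the
    interval.\<close>
  have "uniform_limit {0<..norm S} (\<lambda>k t. poly (P k) t * poly (Q k) t) (\<lambda>t. \<phi> t * \<theta> t) sequentially"
    by (rule bounded_bilinear.bounded_uniform_limit[OF bounded_bilinear_mult PQ])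
       (use assms extendable_bounded in auto)
  moreover have "(\<lambda>k. poly (P k * Q k)) = (\<lambda>k t. poly (P k) t * poly (Q k) t)"
    by (simp add: fun_eq_iff)
  ultimately have "uniform_limit {0<..norm S} (\<lambda>k. poly (P k * Q k)) (\<lambda>t. \<phi> t * \<theta> t) sequentially"
    by simp
  from op_fun_tendsto[OF S this] show ?thesis
    unfolding poly_op_mult
    by (rule LIMSEQ_unique)
       (intro bounded_bilinear.tendsto[OF bounded_bilinear_blinfun_compose] op_fun_tendsto[OF S] PQ)
qed

lemma op_fun_cmult:
  assumes "extendable (norm S) \<phi>"
  shows "op_fun (\<lambda>t. k * \<phi> t) S = k *\<^sub>R op_fun \<phi> S"
  unfolding op_fun_mult[OF extendable_const assms] op_fun_const
  by (rule blinfun_eqI) (simp add: blinfun.bilinear_simps)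

lemma op_fun_diff:
  assumes "extendable (norm S) \<phi>" and "extendable (norm S) \<theta>"
  shows "op_fun (\<lambda>t. \<phi> t - \<theta> t) S = op_fun \<phi> S - op_fun \<theta> S"
  using op_fun_add[OF assms(1) extendable_cmult[OF assms(2), of "-1"]] op_fun_cmult[OF assms(2), of "-1"]
  by simp

lemma op_fun_selfadjoint:
  assumes "extendable (norm S) \<phi>"
  shows "op_fun \<phi> S x \<bullet> y = x \<bullet> op_fun \<phi> S y"
proof -
  obtain P where P: "uniform_limit {0<..norm S} (\<lambda>k. poly (P k)) \<phi> sequentially"
    using assms extendable_poly_limit by metis
  note lim = op_fun_tendsto[OF S P]
  have "(\<lambda>k. poly_op (P k) S x \<bullet> y) \<longlonglongrightarrow> op_fun \<phi> S x \<bullet> y"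
    by (intro tendsto_intros blinfun.tendsto lim)
  moreover have "(\<lambda>k. x \<bullet> poly_op (P k) S y) \<longlonglongrightarrow> x \<bullet> op_fun \<phi> S y"
    by (intro tendsto_intros blinfun.tendsto lim)
  ultimately show ?thesis
    unfolding poly_op_selfadjoint[OF S] by (rule LIMSEQ_unique)
qed

lemma op_fun_nonneg:
  assumes "extendable (norm S) \<phi>" and nn: "\<And>t. 0 < t \<Longrightarrow> t \<le> norm S \<Longrightarrow> 0 \<le> \<phi> t"
  shows "0 \<le> op_fun \<phi> S x \<bullet> x"
proof -
  obtain P where P: "uniform_limit {0<..norm S} (\<lambda>k. poly (P k)) \<phi> sequentially"
    using assms extendable_poly_limit by metis
  have lim: "(\<lambda>k. poly_op (P k) S x \<bullet> x) \<longlonglongrightarrow> op_fun \<phi> S x \<bullet> x"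
    by (intro tendsto_intros blinfun.tendsto op_fun_tendsto[OF S P])
  \<comment> \<open>A polynomial uniformly within \<open>e\<close> of \<phi> is at least
    \<open>- e\<close> on the interval, so adding the constant \<open>e\<close> makes polynomial
    positivity applicable.\<close>
  have lower: "- e * (x \<bullet> x) \<le> op_fun \<phi> S x \<bullet> x" if "0 < e" for e
  proof (rule tendsto_lowerbound[OF lim])
    show "\<forall>\<^sub>F k in sequentially. - e * (x \<bullet> x) \<le> poly_op (P k) S x \<bullet> x"
      using uniform_limitD[OF P that]
    proof eventually_elim
      case (elim k)
      have "0 \<le> poly_op (P k + [:e:]) S x \<bullet> x"
      proof (rule poly_op_nonneg[OF S])
        fix t assume t: "t \<in> {0<..norm S}"
        show "0 \<le> poly (P k + [:e:]) t"
          using elim[rule_format, OF t] nn[of t] t by (auto simp: dist_real_def)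
      qed
      then show ?case
        by (simp add: poly_op_add poly_op_const blinfun.bilinear_simps inner_add_left)
    qed
  qed simp
  show ?thesis
  proof (rule field_le_epsilon)
    fix e :: real assume e: "0 < e"
    \<comment> \<open>The summand 1 keeps the quotient meaningful for \<open>x = 0\<close> and still
      ensures \<open>d * (x \<bullet> x) \<le> e\<close>.\<close>
    define d where "d = e / (x \<bullet> x + 1)"
    have pos: "0 < x \<bullet> x + 1" by (rule add_nonneg_pos) simp_all
    have "d * (x \<bullet> x) \<le> d * (x \<bullet> x + 1)" using e pos by (intro mult_left_mono) (simp_all add: d_def)
    also have "\<dots> = e" using pos by (simp add: d_def)
    finally show "0 \<le> op_fun \<phi> S x \<bullet> x + e" using lower[of d] e pos by (simp add: d_def)
  qed
qed

lemma norm_op_fun_square: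
  assumes "extendable (norm S) \<phi>"
  shows "(norm (op_fun \<phi> S x))\<^sup>2 = op_fun (\<lambda>t. (\<phi> t)\<^sup>2) S x \<bullet> x"
proof -
  have "op_fun (\<lambda>t. (\<phi> t)\<^sup>2) S = op_fun \<phi> S o\<^sub>L op_fun \<phi> S"
    using op_fun_mult[OF assms assms] by (simp add: power2_eq_square)
  then show ?thesis by (simp add: power2_norm_eq_inner op_fun_selfadjoint[OF assms])
qed

end

section \<open>Real powers of a positive operator\<close>

lemma powr_at_right_0:
  fixes q :: real
  assumes "0 < q"
  shows "((\<lambda>t. t powr q) \<longlongrightarrow> 0) (at_right 0)"
proof (rule tendsto_zero_powrI)
  show "((\<lambda>t. t) \<longlongrightarrow> 0) (at_right (0::real))" by (rule tendsto_ident_at)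
  show "((\<lambda>t. q) \<longlongrightarrow> q) (at_right (0::real))" by simp
  show "\<forall>\<^sub>F t in at_right 0. 0 \<le> (t::real)"
    using eventually_at_right_less[of 0] by eventually_elim simp
qed (rule assms)

lemma extendable_powr:
  assumes "0 \<le> r"
  shows "extendable c (\<lambda>t. t powr r)"
proof (cases "r = 0")
  case True
  \<comment> \<open>Formally \<open>0 powr 0 = 0\<close>, whereas the continuous extension is the
    constant 1.\<close>
  show ?thesis by (rule extendableI[where f = "\<lambda>_. 1"]) (use True in auto)
next
  case False
  show ?thesis
    by (rule extendable_limit[where l = 0])
       (use False assms in \<open>auto intro!: continuous_intros powr_at_right_0\<close>)
qed

lemma norm_op_fun_le:
  fixes S :: "'x::{real_inner,banach} \<Rightarrow>\<^sub>L 'x"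
  assumes S: "positive_op S" and \<phi>: "extendable (norm S) \<phi>"
    and le: "\<And>t. 0 < t \<Longrightarrow> t \<le> norm S \<Longrightarrow> \<bar>\<phi> t\<bar> \<le> M" and M: "0 \<le> M"
  shows "norm (op_fun \<phi> S x) \<le> M * norm x"
proof -
  have \<phi>2: "extendable (norm S) (\<lambda>t. (\<phi> t)\<^sup>2)"
    using extendable_mult[OF \<phi> \<phi>] by (simp add: power2_eq_square)
  have "0 \<le> op_fun (\<lambda>t. M\<^sup>2 - (\<phi> t)\<^sup>2) S x \<bullet> x"
  proof (rule op_fun_nonneg[OF S])
    show "extendable (norm S) (\<lambda>t. M\<^sup>2 - (\<phi> t)\<^sup>2)" by (intro extendable_diff extendable_const \<phi>2)
    show "0 \<le> M\<^sup>2 - (\<phi> t)\<^sup>2" if "0 < t" "t \<le> norm S" for t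
      using le[OF that] M by (simp add: abs_le_square_iff[symmetric])
  qed
  then have "(norm (op_fun \<phi> S x))\<^sup>2 \<le> (M * norm x)\<^sup>2"
    unfolding norm_op_fun_square[OF S \<phi>] op_fun_diff[OF S extendable_const \<phi>2] op_fun_const[OF S]
    by (simp add: blinfun.bilinear_simps inner_diff_left power_mult_distrib power2_norm_eq_inner)
  then show ?thesis using M by (meson power2_le_imp_le mult_nonneg_nonneg norm_ge_zero)
qed

lemma op_power_add:
  fixes S :: "'x::{real_inner,banach} \<Rightarrow>\<^sub>L 'x"
  assumes S: "positive_op S" and "0 \<le> r" and "0 \<le> s"
  shows "op_power S (r + s) = op_power S r o\<^sub>L op_power S s"
  unfolding op_power_def powr_add by (intro op_fun_mult[OF S] extendable_powr assms)

lemma op_power_0: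
  fixes S :: "'x::{real_inner,banach} \<Rightarrow>\<^sub>L 'x"
  assumes S: "positive_op S"
  shows "op_power S 0 = id_blinfun"
proof -
  have "op_fun (\<lambda>t. t powr 0) S = op_fun (\<lambda>t. 1) S" by (rule op_fun_cong) simp
  then show ?thesis using op_fun_const[OF S, of 1] by (simp add: op_power_def)
qed

lemma op_power_1:
  fixes S :: "'x::{real_inner,banach} \<Rightarrow>\<^sub>L 'x"
  assumes S: "positive_op S"
  shows "op_power S 1 = S"
proof -
  have "op_fun (\<lambda>t. t powr 1) S = op_fun (\<lambda>t. t) S" by (rule op_fun_cong) simp
  then show ?thesis using op_fun_id[OF S] by (simp add: op_power_def)
qed

text \<open>Integer powers are injective by induction, and a real power is a right factor of some
  integer power.\<close>

lemma op_power_eq_0_imp: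
  fixes S :: "'x::{real_inner,banach} \<Rightarrow>\<^sub>L 'x"
  assumes S: "positive_op S" and inj: "\<And>x. S x = 0 \<Longrightarrow> x = 0" and r: "0 \<le> r"
    and x: "op_power S r x = 0"
  shows "x = 0"
proof -
  have nat_power: "x = 0" if "op_power S (real k) x = 0" for k
    using that
  proof (induction k)
    case 0
    then show ?case by (simp add: op_power_0[OF S])
  next
    case (Suc k)
    have "op_power S (real (Suc k)) = S o\<^sub>L op_power S (real k)"
      using op_power_add[OF S, of 1 "real k"] op_power_1[OF S] by (simp add: add.commute)
    then show ?case using Suc inj by simp
  qed
  obtain k where k: "r \<le> real k" using real_arch_simple by blast
  have "op_power S (real k) = op_power S (real k - r) o\<^sub>L op_power S r"
    using op_power_add[OF S, of "real k - r" r] k r by simp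
  then show ?thesis using nat_power[of k] x by (simp add: blinfun.zero_right)
qed

lemma norm_op_power_le:
  fixes S :: "'x::{real_inner,banach} \<Rightarrow>\<^sub>L 'x"
  assumes S: "positive_op S" and r: "0 \<le> r"
  shows "norm (op_power S r x) \<le> norm S powr r * norm x"
  unfolding op_power_def
  by (rule norm_op_fun_le[OF S extendable_powr[OF r]]) (use r in \<open>auto intro: powr_mono2\<close>)

section \<open>The inverse of an unbounded operator\<close>

text \<open>Strict positivity bounds \<open>B\<close> from below, so \<open>B\<close> is injective
  and its range is closed; self-adjointness makes the orthogonal complement of the range part of the
  kernel. Hence \<open>B\<close> maps \<open>D\<close> onto the whole space and
  \<open>the_inv_into\<close> is a genuine two-sided inverse.\<close>

lemma positive_op_inverse:
  fixes G :: "'x::{real_inner,banach} \<Rightarrow>\<^sub>L 'x"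
  assumes lin: "linear_operator_on D B" and dense: "densely_defined D" and unb: "unbounded_on D B"
    and sa: "self_adjoint_on D B" and pos: "strictly_positive_on D B"
    and G: "blinfun_apply G = the_inv_into D B"
  shows "positive_op G" and "G x = 0 \<Longrightarrow> x = 0"
proof -
  obtain \<gamma> where \<gamma>: "0 < \<gamma>" "\<And>x. x \<in> D \<Longrightarrow> \<gamma> * (norm x)\<^sup>2 \<le> B x \<bullet> x"
    using pos by (auto simp: strictly_positive_on_def)
  have D: "subspace D" and B_add: "\<And>x y. x \<in> D \<Longrightarrow> y \<in> D \<Longrightarrow> B (x + y) = B x + B y"
    and B_scale: "\<And>c x. x \<in> D \<Longrightarrow> B (c *\<^sub>R x) = c *\<^sub>R B x"
    using lin by (auto simp: linear_operator_on_def)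
  have B_diff: "B (x - y) = B x - B y" if "x \<in> D" "y \<in> D" for x y
    using B_add[of x "(-1) *\<^sub>R y"] B_scale[of y "-1"] that subspace_scale[OF D, of y "-1"] by simp
  have sym: "B x \<bullet> y = x \<bullet> B y" if "x \<in> D" "y \<in> D" for x y
  proof -
    have "(y, B y) \<in> adjoint_graph D B" using sa that unfolding self_adjoint_on_def by blast
    then show ?thesis using that by (auto simp: adjoint_graph_def)
  qed
  \<comment> \<open>The other half of self-adjointness: any pair satisfying the adjoint relation
    already lies in the graph of \<open>B\<close>.\<close>
  have graph: "y \<in> D \<and> B y = z" if "\<And>x. x \<in> D \<Longrightarrow> B x \<bullet> y = x \<bullet> z" for y z
  proof -
    have "(y, z) \<in> adjoint_graph D B" using that by (auto simp: adjoint_graph_def)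
    then show ?thesis using sa unfolding self_adjoint_on_def by auto
  qed
  have lower: "\<gamma> * norm x \<le> norm (B x)" if "x \<in> D" for x
  proof (cases "x = 0")
    case False
    have "(\<gamma> * norm x) * norm x \<le> norm (B x) * norm x"
      using \<gamma>(2)[OF that] norm_cauchy_schwarz[of "B x" x] by (simp add: power2_eq_square)
    then show ?thesis using False by simp
  qed simp
  have inj: "inj_on B D"
  proof (rule inj_onI)
    fix x y assume xy: "x \<in> D" "y \<in> D" "B x = B y"
    have "\<gamma> * norm (x - y) \<le> 0"
      using lower[OF subspace_diff[OF D xy(1,2)]] xy by (simp add: B_diff)
    then show "x = y" using \<gamma>(1) by (simp add: mult_le_0_iff)
  qed
  have sub: "subspace (B ` D)"
  proof (rule subspaceI)
    have "B 0 = 0" using B_scale[of 0 0] subspace_0[OF D] by simp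
    then show "0 \<in> B ` D" using subspace_0[OF D] by force
  next
    fix u v assume "u \<in> B ` D" "v \<in> B ` D"
    then obtain x y where xy: "x \<in> D" "y \<in> D" "u = B x" "v = B y" by blast
    then have "u + v = B (x + y)" by (simp add: B_add)
    then show "u + v \<in> B ` D" using subspace_add[OF D xy(1,2)] by blast
  next
    fix c u assume "u \<in> B ` D"
    then obtain x where x: "x \<in> D" "u = B x" by blast
    then have "c *\<^sub>R u = B (c *\<^sub>R x)" by (simp add: B_scale)
    then show "c *\<^sub>R u \<in> B ` D" using subspace_scale[OF D x(1)] by blast
  qed
  have "closed (B ` D)"
    unfolding closed_sequential_limits
  proof (intro allI impI)
    fix u l assume "(\<forall>k. u k \<in> B ` D) \<and> u \<longlonglongrightarrow> l"
    then have u: "\<And>k. u k \<in> B ` D" and ul: "u \<longlonglongrightarrow> l" by auto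
    define d where "d k = the_inv_into D B (u k)" for k
    have d: "d k \<in> D" "B (d k) = u k" for k
      unfolding d_def using the_inv_into_into[OF inj u subset_refl] f_the_inv_into_f[OF inj u] by auto
    \<comment> \<open>The lower bound on \<open>B\<close> transfers the Cauchy property from the
      images to the preimages.\<close>
    have "Cauchy d"
    proof (rule metric_CauchyI)
      fix e :: real assume "0 < e"
      then have "0 < \<gamma> * e" using \<gamma> by simp
      then obtain N where N: "\<And>k l. k \<ge> N \<Longrightarrow> l \<ge> N \<Longrightarrow> dist (u k) (u l) < \<gamma> * e"
        using LIMSEQ_imp_Cauchy[OF ul] unfolding Cauchy_def by blast
      show "\<exists>N. \<forall>k\<ge>N. \<forall>l\<ge>N. dist (d k) (d l) < e"
      proof (intro exI allI impI)
        fix k l assume "N \<le> k" "N \<le> l"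
        then have "\<gamma> * dist (d k) (d l) < \<gamma> * e"
          using lower[OF subspace_diff[OF D d(1) d(1)], of k l] N[of k l]
          by (simp add: dist_norm B_diff d)
        then show "dist (d k) (d l) < e" using \<gamma> by simp
      qed
    qed
    then obtain x where x: "d \<longlonglongrightarrow> x" using Cauchy_convergent_iff convergent_def by blast
    \<comment> \<open>The adjoint relation survives the limit, which amounts to closedness of the
      graph of \<open>B\<close>.\<close>
    have "B v \<bullet> x = v \<bullet> l" if "v \<in> D" for v
    proof (rule LIMSEQ_unique)
      show "(\<lambda>k. B v \<bullet> d k) \<longlonglongrightarrow> B v \<bullet> x" by (intro tendsto_intros x)
      show "(\<lambda>k. B v \<bullet> d k) \<longlonglongrightarrow> v \<bullet> l"
        using sym[OF that d(1)] d(2) by (simp add: tendsto_inner ul)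
    qed
    then show "l \<in> B ` D" using graph by blast
  qed
  have surj: "x \<in> B ` D" for x
  proof -
    obtain q where q: "q \<in> B ` D" "\<And>y. y \<in> B ` D \<Longrightarrow> (x - q) \<bullet> y = 0"
      using orthogonal_projection_exists[OF sub \<open>closed (B ` D)\<close>] by blast
    \<comment> \<open>Orthogonality to the range says that \<open>(x - q, 0)\<close> belongs to the
      adjoint graph.\<close>
    have "x - q \<in> D \<and> B (x - q) = 0"
      by (rule graph) (use q(2) in \<open>simp add: inner_commute\<close>)
    then have "\<gamma> * norm (x - q) \<le> 0" using lower[of "x - q"] by simp
    then show ?thesis using q(1) \<gamma>(1) by (simp add: mult_le_0_iff)
  qed
  have GD: "G x \<in> D" and BG: "B (G x) = x" for x
    unfolding G using the_inv_into_into[OF inj surj subset_refl] f_the_inv_into_f[OF inj surj] by auto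
  have B0: "B 0 = 0" using B_scale[of 0 0] subspace_0[OF D] by simp
  show inj_G: "G x = 0 \<Longrightarrow> x = 0" for x using BG[of x] B0 by simp
  have "G x \<bullet> y = x \<bullet> G y" for x y
    using sym[OF GD GD, of x y] by (simp add: BG)
  moreover have "0 \<le> G x \<bullet> x" for x
    using \<gamma>(2)[OF GD, of x] \<gamma>(1) unfolding BG
    by (smt (verit) inner_commute mult_nonneg_nonneg zero_le_power2)
  moreover have "G \<noteq> 0"
  proof
    assume "G = 0"
    \<comment> \<open>An injective zero operator lives on the trivial space, where \<open>B\<close>
      would be bounded.\<close>
    then have zero: "x = 0" for x :: 'x using inj_G[of x] by simp
    have "norm (B x) \<le> 0 * norm x" for x using zero[of "B x"] by simp
    then show False using unb unfolding unbounded_on_def by blast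
  qed
  ultimately show "positive_op G" by (simp add: positive_op_def)
qed

section \<open>The discrepancy principle\<close>

text \<open>Used with \<open>x k = t / \<alpha> k\<close>, so that \<open>s\<close> is
  \<sigma>\<open>* t\<close> and \<open>1 / Q\<close> is the residual factor of the method. The
  second bound reflects \<open>2 (Q - 1) / (Q + 1) \<le> ln Q \<le> s\<close>, but is proved by
  adding one factor at a time.\<close>

lemma prod_sum_bounds:
  fixes x :: "nat \<Rightarrow> real"
  assumes "\<And>k. k \<in> {1..n} \<Longrightarrow> 0 \<le> x k"
  defines "s \<equiv> (\<Sum>k=1..n. x k)" and "Q \<equiv> (\<Prod>k=1..n. 1 + x k)"
  shows "1 + s \<le> Q" and "2 * (Q - 1) \<le> s * (Q + 1)"
proof -
  have "0 \<le> s \<and> 1 + s \<le> Q \<and> 2 * (Q - 1) \<le> s * (Q + 1)"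
    using assms(1) unfolding s_def Q_def
  proof (induction n)
    case (Suc n)
    define u R where "u = (\<Sum>k=1..n. x k)" and "R = (\<Prod>k=1..n. 1 + x k)"
    define v where "v = x (Suc n)"
    have IH: "0 \<le> u" "1 + u \<le> R" "2 * (R - 1) \<le> u * (R + 1)"
      using Suc unfolding u_def R_def by auto
    have v: "0 \<le> v" using Suc.prems[of "Suc n"] by (simp add: v_def)
    have "1 \<le> R" using IH by linarith
    \<comment> \<open>A new factor \<open>1 + v\<close> increases the gap in the second bound by
      \<open>v * (u * R - (R - 1)) + R * v * v\<close>. This chain, based on
      \<open>R + 1 \<le> 2 * R\<close>, makes the first bracket nonnegative.\<close>
    have "(R - 1) * (R + 1) \<le> (2 * (R - 1)) * R" using zero_le_power2[of "R - 1"] by (simp add: power2_eq_square algebra_simps)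
    also have "\<dots> \<le> (u * (R + 1)) * R" using IH(3) \<open>1 \<le> R\<close> by (intro mult_right_mono) auto
    finally have "(R - 1) * (R + 1) \<le> (u * R) * (R + 1)" by (simp add: mult_ac)
    then have uR: "R - 1 \<le> u * R" using \<open>1 \<le> R\<close> by simp
    have "1 + (u + v) \<le> R * (1 + v)"
      using IH(2) mult_right_mono[OF \<open>1 \<le> R\<close> v] by (simp add: algebra_simps)
    moreover have "2 * (R * (1 + v) - 1) \<le> (u + v) * (R * (1 + v) + 1)"
    proof -
      have "0 \<le> v * (u * R - (R - 1)) + R * v * v" using uR v \<open>1 \<le> R\<close> by simp
      then show ?thesis using IH(3) by (simp add: algebra_simps)
    qed
    ultimately show ?case using IH(1) v by (simp add: u_def R_def v_def)
  qed simp
  then show "1 + s \<le> Q" and "2 * (Q - 1) \<le> s * (Q + 1)" by simp_all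
qed

text \<open>\<open>f\<close> continues the filter to 0. Since \<open>1 - P * (\<alpha> / (t +
  \<alpha>)) = (1 - P) + t * P / (t + \<alpha>)\<close>, each new factor adds the term
  \<open>P / (t + \<alpha>)\<close>, and no division by \<open>t\<close> occurs.\<close>

lemma filter_extension:
  fixes \<alpha> :: "nat \<Rightarrow> real"
  assumes "\<And>k. k \<in> {1..n} \<Longrightarrow> 0 < \<alpha> k"
  shows "\<exists>f. continuous_on {0..} f \<and> (\<forall>t\<ge>0. 0 \<le> f t \<and> (1 \<le> n \<longrightarrow> 0 < f t) \<and>
    t * f t = 1 - (\<Prod>k=1..n. \<alpha> k / (t + \<alpha> k)))"
  using assms
proof (induction n)
  case 0
  show ?case by (intro exI[of _ "\<lambda>_. 0"]) simp
next
  case (Suc n)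
  then obtain f where f: "continuous_on {0..} f" "\<And>t. t \<ge> 0 \<Longrightarrow> 0 \<le> f t"
      "\<And>t. t \<ge> 0 \<Longrightarrow> t * f t = 1 - (\<Prod>k=1..n. \<alpha> k / (t + \<alpha> k))" by fastforce
  have pos: "0 < t + \<alpha> k" if "0 \<le> t" "k \<in> {1..Suc n}" for t k using Suc.prems[OF that(2)] that(1) by simp
  define g where "g t = f t + (\<Prod>k=1..n. \<alpha> k / (t + \<alpha> k)) / (t + \<alpha> (Suc n))" for t
  have "continuous_on {0..} g"
    unfolding g_def using pos
    by (intro continuous_intros f(1)) (auto simp: less_imp_neq[symmetric] dest!: less_imp_neq)
  moreover have "0 < g t" if "0 \<le> t" for t
    unfolding g_def using f(2)[OF that] pos[OF that] Suc.prems that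
    by (intro add_nonneg_pos divide_pos_pos prod_pos) auto
  moreover have "t * g t = 1 - (\<Prod>k=1..Suc n. \<alpha> k / (t + \<alpha> k))" if "0 \<le> t" for t
  proof -
    define P where "P = (\<Prod>k=1..n. \<alpha> k / (t + \<alpha> k))"
    have "t * g t = t * f t + P * (t / (t + \<alpha> (Suc n)))"
      by (simp add: g_def P_def distrib_left)
    also have "t / (t + \<alpha> (Suc n)) = 1 - \<alpha> (Suc n) / (t + \<alpha> (Suc n))"
      using pos[OF that, of "Suc n"] by (simp add: field_simps)
    also have "t * f t = 1 - P" using f(3)[OF that] by (simp add: P_def)
    finally show ?thesis by (simp add: P_def right_diff_distrib)
  qed
  ultimately show ?case by (intro exI[of _ g]) (auto intro: less_imp_le)
qed

lemma extendable_g_filter: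
  assumes "\<And>k. k \<in> {1..n} \<Longrightarrow> 0 < \<alpha> k"
  shows "extendable c (g_filter \<alpha> n)"
proof -
  obtain f where f: "continuous_on {0..} f"
    "\<And>t. t \<ge> 0 \<Longrightarrow> t * f t = 1 - (\<Prod>k=1..n. \<alpha> k / (t + \<alpha> k))"
    using filter_extension[of n \<alpha>] assms by fastforce
  show ?thesis
  proof (rule extendableI)
    show "continuous_on {0..c} f" using f(1) by (rule continuous_on_subset) auto
    fix t :: real assume t: "0 < t"
    have "g_filter \<alpha> n t = 1 / t * (t * f t)"
      by (simp only: g_filter_def f(2)[OF less_imp_le[OF t]])
    then show "g_filter \<alpha> n t = f t" using t by simp
  qed
qed

text \<open>\<kappa> is the quotient of the residual factor by the filter and equals
  \<open>t / (Q - 1)\<close>. The two upper and lower bounds other than nonnegativity are those of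
  \<open>prod_sum_bounds\<close> divided by \<open>Q - 1\<close>.\<close>

lemma g_filter_companion:
  assumes \<alpha>: "\<And>k. k \<in> {1..n} \<Longrightarrow> 0 < \<alpha> k" and n: "1 \<le> n"
  defines "\<sigma> \<equiv> (\<Sum>k=1..n. 1 / \<alpha> k)"
  obtains \<kappa> where "\<And>c. extendable c \<kappa>"
    and "\<And>t. 0 < t \<Longrightarrow> \<kappa> t * g_filter \<alpha> n t = 1 - t * g_filter \<alpha> n t"
    and "\<And>t. 0 < t \<Longrightarrow> 0 \<le> \<sigma> * \<kappa> t" and "\<And>t. 0 < t \<Longrightarrow> \<sigma> * \<kappa> t \<le> 1"
    and "\<And>t. 0 < t \<Longrightarrow> 1 \<le> \<sigma> / 2 * t + \<sigma> * \<kappa> t"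
proof -
  obtain f where f: "continuous_on {0..} f" "\<And>t. t \<ge> 0 \<Longrightarrow> 0 < f t"
    "\<And>t. t \<ge> 0 \<Longrightarrow> t * f t = 1 - (\<Prod>k=1..n. \<alpha> k / (t + \<alpha> k))"
    using filter_extension[of n \<alpha>] \<alpha> n by fastforce
  have g: "g_filter \<alpha> n t = f t" if t: "0 < t" for t
  proof -
    have "g_filter \<alpha> n t = 1 / t * (t * f t)"
      by (simp only: g_filter_def f(3)[OF less_imp_le[OF t]])
    then show ?thesis using t by simp
  qed
  \<comment> \<open>Dividing by the positive \<open>f\<close> instead of \<open>Q - 1\<close> keeps
    the formula continuous at 0.\<close>
  define \<kappa> where "\<kappa> = (\<lambda>t. (1 - t * f t) / f t)"
  have \<sigma>: "0 < \<sigma>" unfolding \<sigma>_def using n \<alpha> by (intro sum_pos) auto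
  have \<kappa>: "0 \<le> \<sigma> * \<kappa> t \<and> \<sigma> * \<kappa> t \<le> 1 \<and> 1 \<le> \<sigma> / 2 * t + \<sigma> * \<kappa> t" if t: "0 < t" for t
  proof -
    define Q where "Q = (\<Prod>k=1..n. 1 + t / \<alpha> k)"
    have s: "(\<Sum>k=1..n. t / \<alpha> k) = \<sigma> * t" by (simp add: \<sigma>_def sum_distrib_right)
    have Q: "1 + \<sigma> * t \<le> Q" "2 * (Q - 1) \<le> \<sigma> * t * (Q + 1)"
      using prod_sum_bounds[of n "\<lambda>k. t / \<alpha> k", unfolded s] \<alpha> t
      by (simp_all add: Q_def less_imp_le)
    have "0 < \<sigma> * t" using \<sigma> t by simp
    then have Q1: "1 < Q" using Q(1) by linarith
    have "(\<Prod>k=1..n. \<alpha> k / (t + \<alpha> k)) = (\<Prod>k=1..n. 1 / (1 + t / \<alpha> k))"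
      by (intro prod.cong refl) (use \<alpha> in \<open>force simp: field_simps\<close>)
    then have R: "1 - t * f t = 1 / Q"
      using f(3)[of t] t by (simp add: Q_def prod_dividef)
    have "f t = (1 - 1 / Q) / t" using R t by (simp add: field_simps)
    then have "\<kappa> t = t / (Q - 1)" using R Q1 t f(2)[of t] unfolding \<kappa>_def by (simp add: field_simps)
    then have eq: "\<sigma> * \<kappa> t = \<sigma> * t / (Q - 1)" by simp
    have "1 \<le> \<sigma> / 2 * t + \<sigma> * t / (Q - 1)"
    proof -
      have "\<sigma> / 2 * t + \<sigma> * t / (Q - 1) = \<sigma> * t * (Q + 1) / (2 * (Q - 1))"
        using Q1 by (simp add: field_simps)
      then show ?thesis using Q(2) Q1 by simp
    qed
    then show ?thesis unfolding eq using Q(1) Q1 \<open>0 < \<sigma> * t\<close> by simp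
  qed
  have "continuous_on {0..c} \<kappa>" for c
    unfolding \<kappa>_def
    by (intro continuous_intros continuous_on_subset[OF f(1)])
       (use f(2) in \<open>force+\<close>)
  then have "extendable c \<kappa>" for c by (rule extendable_continuous)
  moreover have "\<kappa> t * g_filter \<alpha> n t = 1 - t * g_filter \<alpha> n t" if "0 < t" for t
    using f(2)[of t] that by (simp add: g \<kappa>_def)
  ultimately show thesis using that \<kappa> by blast
qed

section \<open>The normal operator and the damped error\<close>

lemma adj_compose_apply:
  fixes T :: "'x::{real_inner,banach} \<Rightarrow>\<^sub>L 'y::real_inner"
  shows "(adj T o\<^sub>L T) x \<bullet> y = T x \<bullet> T y"
  using inner_adj[of T y "T x"] by (simp add: inner_commute)

lemma positive_op_adj_compose:
  fixes T :: "'x::{real_inner,banach} \<Rightarrow>\<^sub>L 'y::real_inner"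
  assumes "T \<noteq> 0"
  shows "positive_op (adj T o\<^sub>L T)"
proof -
  obtain x where "T x \<noteq> 0" using assms by (metis blinfun_eqI zero_blinfun.rep_eq)
  then have "(adj T o\<^sub>L T) x \<bullet> x \<noteq> 0" unfolding adj_compose_apply by simp
  then have "adj T o\<^sub>L T \<noteq> 0" by (metis blinfun.zero_left inner_zero_left)
  moreover have "(adj T o\<^sub>L T) x \<bullet> y = x \<bullet> (adj T o\<^sub>L T) y" for x y
    using adj_compose_apply[of T x y] adj_compose_apply[of T y x] by (metis inner_commute)
  moreover have "0 \<le> (adj T o\<^sub>L T) x \<bullet> x" for x by (simp only: adj_compose_apply inner_ge_zero)
  ultimately show ?thesis unfolding positive_op_def by blast
qed

text \<open>The filter identity expresses \<open>W zn\<close> through the residual, and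
  \<open>le\<close> fixes the sign of the resulting cross term; \<open>w\<close> is the damped error
  \<open>- W h\<close>.\<close>

lemma discrepancy_estimate:
  fixes T :: "'x::{real_inner,banach} \<Rightarrow>\<^sub>L 'y::real_inner"
  assumes T: "T \<noteq> 0" and \<alpha>: "\<And>k. k \<in> {1..n} \<Longrightarrow> 0 < \<alpha> k" and n: "1 \<le> n"
    and zn: "zn = op_fun (g_filter \<alpha> n) (adj T o\<^sub>L T) (adj T yd)"
    and le: "norm (yd - T z) \<le> norm (yd - T zn)"
  obtains w where "(norm (zn - z))\<^sup>2 \<le> z \<bullet> w" and "norm w \<le> norm (zn - z)"
    and "norm (T w) \<le> norm (T (zn - z))"
proof -
  define S where "S = adj T o\<^sub>L T"
  define \<sigma> where "\<sigma> = (\<Sum>k=1..n. 1 / \<alpha> k)"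
  define g where "g = g_filter \<alpha> n"
  define h res where "h = zn - z" and "res = yd - T zn"
  have S: "positive_op S" unfolding S_def by (rule positive_op_adj_compose[OF T])
  have S_inner: "S x \<bullet> y = T x \<bullet> T y" for x y unfolding S_def by (rule adj_compose_apply)
  obtain \<kappa> where \<kappa>: "\<And>c. extendable c \<kappa>" "\<And>t. 0 < t \<Longrightarrow> \<kappa> t * g t = 1 - t * g t"
      "\<And>t. 0 < t \<Longrightarrow> 0 \<le> \<sigma> * \<kappa> t" "\<And>t. 0 < t \<Longrightarrow> \<sigma> * \<kappa> t \<le> 1"
      "\<And>t. 0 < t \<Longrightarrow> 1 \<le> \<sigma> / 2 * t + \<sigma> * \<kappa> t"
    using g_filter_companion[of n \<alpha>, OF \<alpha> n] unfolding \<sigma>_def g_def by blast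
  define W where "W = op_fun (\<lambda>t. \<sigma> * \<kappa> t) S"
  have ext_g: "extendable c g" for c unfolding g_def by (rule extendable_g_filter[of n \<alpha>, OF \<alpha>])
  have ext_W: "extendable c (\<lambda>t. \<sigma> * \<kappa> t)" for c by (intro extendable_cmult \<kappa>)
  note ext = extendable_const extendable_id extendable_cmult extendable_add extendable_diff
    extendable_mult \<kappa>(1) ext_g ext_W
  have W_sa: "W x \<bullet> y = x \<bullet> W y" for x y unfolding W_def by (rule op_fun_selfadjoint[OF S ext_W])
  have "op_fun \<kappa> S o\<^sub>L op_fun g S = op_fun (\<lambda>t. 1 - t * g t) S"
    unfolding op_fun_mult[OF S \<kappa>(1) ext_g, symmetric] by (rule op_fun_cong) (use \<kappa>(2) in auto)
  also have "\<dots> = id_blinfun - (S o\<^sub>L op_fun g S)"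
    by (simp add: op_fun_diff[OF S] op_fun_mult[OF S] op_fun_const[OF S] op_fun_id[OF S] ext)
  finally have eq: "op_fun \<kappa> S o\<^sub>L op_fun g S = id_blinfun - (S o\<^sub>L op_fun g S)" .
  have zn': "zn = op_fun g S (adj T yd)" by (simp add: zn g_def S_def)
  have "op_fun \<kappa> S zn = (op_fun \<kappa> S o\<^sub>L op_fun g S) (adj T yd)" by (simp add: zn')
  also have "\<dots> = adj T yd - S zn" unfolding eq by (simp add: zn' blinfun.bilinear_simps)
  also have "\<dots> = adj T res" by (simp add: S_def res_def blinfun.bilinear_simps)
  finally have W_zn: "W zn = \<sigma> *\<^sub>R adj T res"
    by (simp add: W_def op_fun_cmult[OF S \<kappa>(1)] blinfun.bilinear_simps)
  define w where "w = - W h"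
  \<comment> \<open>\<open>res + T h\<close> is the data error \<open>yd - T z\<close>, so squaring
    \<open>le\<close> and cancelling the squared residual leaves this cross term.\<close>
  have Th: "2 * (res \<bullet> T h) \<le> - (T h \<bullet> T h)"
  proof -
    have eq: "yd - T z = res + T h" by (simp add: res_def h_def blinfun.bilinear_simps)
    have "norm (res + T h) \<le> norm res" using le[unfolded eq, folded res_def] .
    then have "(norm (res + T h))\<^sup>2 \<le> (norm res)\<^sup>2" by (rule power_mono) simp
    then show ?thesis
      by (simp add: power2_norm_eq_inner inner_add_left inner_add_right inner_commute)
  qed
  have "(norm h)\<^sup>2 \<le> z \<bullet> w"
  proof -
    have "0 \<le> op_fun (\<lambda>t. (\<sigma> / 2 * t + \<sigma> * \<kappa> t) - 1) S h \<bullet> h"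
    proof (rule op_fun_nonneg[OF S])
      show "extendable (norm S) (\<lambda>t. (\<sigma> / 2 * t + \<sigma> * \<kappa> t) - 1)" by (intro ext)
    qed (use \<kappa>(5) in simp)
    also have "op_fun (\<lambda>t. (\<sigma> / 2 * t + \<sigma> * \<kappa> t) - 1) S = (\<sigma> / 2) *\<^sub>R S + W - id_blinfun"
      unfolding W_def
      by (subst op_fun_diff[OF S], (intro ext)+, subst op_fun_add[OF S], (intro ext)+,
          subst op_fun_cmult[OF S extendable_id]) (simp add: op_fun_const[OF S] op_fun_id[OF S])
    finally have 1: "(norm h)\<^sup>2 \<le> \<sigma> / 2 * (T h \<bullet> T h) + W h \<bullet> h"
      by (simp add: blinfun.bilinear_simps inner_add_left inner_diff_left S_inner power2_norm_eq_inner)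
    \<comment> \<open>Substituting \<open>z = zn - h\<close> produces the residual term. By
      \<open>Th\<close> it contributes at least \<open>\<sigma> / 2 * (T h \<bullet> T h)\<close>,
      exactly what inequality 1 needs.\<close>
    have "z \<bullet> w = W h \<bullet> h - W zn \<bullet> h"
      by (simp add: w_def h_def W_sa blinfun.bilinear_simps inner_diff_left inner_diff_right)
    also have "W zn \<bullet> h = \<sigma> * (res \<bullet> T h)"
      using inner_adj[of T h res] by (simp add: W_zn inner_commute)
    finally have 2: "z \<bullet> w = W h \<bullet> h - \<sigma> * (res \<bullet> T h)" .
    have "0 \<le> \<sigma>" unfolding \<sigma>_def using \<alpha> by (intro sum_nonneg) (simp add: less_imp_le)
    then have "\<sigma> * (2 * (res \<bullet> T h)) \<le> \<sigma> * (- (T h \<bullet> T h))" using Th by (rule mult_left_mono[rotated])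
    then show ?thesis using 1 2 by simp
  qed
  moreover have "norm w \<le> norm h"
    using norm_op_fun_le[OF S ext_W, of 1 h] \<kappa>(3,4) by (simp add: w_def W_def)
  moreover have "norm (T w) \<le> norm (T h)"
  proof -
    \<comment> \<open>The squared norm of \<open>T (W h)\<close> is the form of \<open>W S W\<close>
      at \<open>h\<close>, and the multiplier of \<open>W\<close> lies between 0 and 1.\<close>
    have "0 \<le> op_fun (\<lambda>t. t - (\<sigma> * \<kappa> t) * (t * (\<sigma> * \<kappa> t))) S h \<bullet> h"
    proof (rule op_fun_nonneg[OF S])
      show "extendable (norm S) (\<lambda>t. t - (\<sigma> * \<kappa> t) * (t * (\<sigma> * \<kappa> t)))" by (intro ext)
      fix t :: real assume t: "0 < t"
      have "(\<sigma> * \<kappa> t) * (\<sigma> * \<kappa> t) \<le> 1 * 1" using \<kappa>(3,4)[OF t] by (intro mult_mono) auto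
      then have "t * ((\<sigma> * \<kappa> t) * (\<sigma> * \<kappa> t)) \<le> t * 1" using t by (intro mult_left_mono) auto
      then show "0 \<le> t - (\<sigma> * \<kappa> t) * (t * (\<sigma> * \<kappa> t))" by (simp add: mult_ac)
    qed
    also have "op_fun (\<lambda>t. t - (\<sigma> * \<kappa> t) * (t * (\<sigma> * \<kappa> t))) S = S - (W o\<^sub>L (S o\<^sub>L W))"
      unfolding W_def
      by (subst op_fun_diff[OF S], (intro ext)+, subst op_fun_mult[OF S], (intro ext)+,
          subst op_fun_mult[OF S], (intro ext)+) (simp add: op_fun_id[OF S])
    finally have "T (W h) \<bullet> T (W h) \<le> T h \<bullet> T h"
      by (simp add: blinfun.bilinear_simps inner_diff_left W_sa S_inner)
    then show ?thesis by (simp add: w_def blinfun.bilinear_simps norm_le)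
  qed
  ultimately show thesis using that[of w] by (simp add: h_def)
qed

section \<open>Index functions and interpolation\<close>

text \<open>The slope is the infimum of the secant slopes to the right of \<open>t0\<close>. Letting
  \<open>t\<close> tend to 0 in the line inequality gives \<open>f t0 \<le> \<beta> * t0\<close>,
  which later makes the coefficient of \<open>(norm u)^2\<close> nonpositive.\<close>

lemma supporting_line:
  fixes f :: "real \<Rightarrow> real"
  assumes cvx: "convex_on {0<..b} f" and t0: "0 < t0" "t0 < b" and lim: "(f \<longlongrightarrow> 0) (at_right 0)"
  obtains \<beta> where "\<And>t. 0 < t \<Longrightarrow> t \<le> b \<Longrightarrow> f t0 + \<beta> * (t - t0) \<le> f t" and "f t0 \<le> \<beta> * t0"
proof -
  define \<beta> where "\<beta> = Inf ((\<lambda>t. (f t0 - f t) / (t0 - t)) ` ({t0<..} \<inter> {0<..b}))"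
  have "t0 \<in> {0<..<b}" using t0 by simp
  then have int: "t0 \<in> interior {0<..b}"
    by (rule interiorI[OF open_greaterThanLessThan]) auto
  have le: "f t0 + \<beta> * (t - t0) \<le> f t" if "0 < t" "t \<le> b" for t
    using convex_le_Inf_differential[OF cvx int, of t] that unfolding \<beta>_def by simp
  have "f t0 + \<beta> * (0 - t0) \<le> 0"
  proof (rule tendsto_le[OF _ lim])
    show "((\<lambda>t. f t0 + \<beta> * (t - t0)) \<longlongrightarrow> f t0 + \<beta> * (0 - t0)) (at_right 0)"
      by (intro tendsto_intros)
    show "\<forall>\<^sub>F t in at_right 0. f t0 + \<beta> * (t - t0) \<le> f t"
      using eventually_at_right_less[of 0] eventually_at_rightI[of 0 b "\<lambda>t. t \<le> b"] t0
      by (auto elim!: eventually_elim2 intro: le)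
  qed simp
  then show thesis using that[of \<beta>] le by simp
qed

section \<open>Index functions, their inverses and tangents\<close>

lemma index_functionD:
  assumes "index_function a b \<phi>"
  shows "0 < t \<Longrightarrow> t \<le> a \<Longrightarrow> 0 < \<phi> t" and "continuous_on {0<..a} \<phi>"
    and "0 < t \<Longrightarrow> t < u \<Longrightarrow> u \<le> a \<Longrightarrow> \<phi> t < \<phi> u" and "(\<phi> \<longlongrightarrow> 0) (at_right 0)"
  using assms unfolding index_function_def
  by (auto intro: strict_mono_onD simp: image_subset_iff)

lemma extendable_index_function: "index_function a b \<phi> \<Longrightarrow> extendable a \<phi>"
  by (intro extendable_limit[where l = 0] index_functionD)

lemma psi_index_function:
  assumes \<rho>: "index_function a b \<rho>" and "0 < a" and r: "0 \<le> r"
  shows "index_function a (psi \<rho> r a) (psi \<rho> r)"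
proof -
  note D = index_functionD[OF \<rho>]
  have mono: "psi \<rho> r t < psi \<rho> r u" if "0 < t" "t < u" "u \<le> a" for t u
    unfolding psi_def
    by (rule mult_le_less_imp_less)
       (use that r D(1)[of t] D(3)[of t u] in \<open>auto intro: powr_mono2\<close>)
  have "psi \<rho> r t \<le> psi \<rho> r a" if "0 < t" "t \<le> a" for t
    using mono[of t a] that by (cases "t = a") auto
  moreover have "0 < psi \<rho> r t" if "0 < t" "t \<le> a" for t
    using D(1)[of t] that by (simp add: psi_def)
  moreover have "(psi \<rho> r \<longlongrightarrow> 0) (at_right 0)"
  proof (cases "r = 0")
    case True
    have "\<forall>\<^sub>F t in at_right 0. \<rho> t = psi \<rho> r t"
      using eventually_at_right_less[of 0] by eventually_elim (simp add: psi_def True)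
    then show ?thesis by (rule Lim_transform_eventually[OF D(4)])
  next
    case False
    then have "((\<lambda>t. t powr r * \<rho> t) \<longlongrightarrow> 0 * 0) (at_right 0)"
      using r by (intro tendsto_mult powr_at_right_0 D(4)) auto
    then show ?thesis by (simp add: psi_def[abs_def])
  qed
  moreover have "continuous_on {0<..a} (psi \<rho> r)"
    unfolding psi_def[abs_def] by (intro continuous_intros D(2)) auto
  ultimately show ?thesis
    unfolding index_function_def by (auto intro!: strict_mono_onI mono)
qed

text \<open>Beyond \<open>\<phi> a\<close> the inverse is capped at \<open>a\<close>, so the
  defining equation is claimed only for values below \<open>a\<close>; existence there is the
  intermediate value theorem.\<close>

lemma index_inv_cases:
  assumes \<phi>: "index_function a b \<phi>" and a: "0 < a" and t: "0 < t"
  shows "0 < index_inv a \<phi> t" and "index_inv a \<phi> t \<le> a"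
    and "index_inv a \<phi> t < a \<Longrightarrow> \<phi> (index_inv a \<phi> t) = t"
proof -
  note D = index_functionD[OF \<phi>]
  have inj: "inj_on \<phi> {0<..a}"
    using \<phi> by (auto simp: index_function_def intro: strict_mono_on_imp_inj_on)
  have surj: "\<exists>u\<in>{0<..a}. \<phi> u = t" if ta: "t \<le> \<phi> a"
  proof -
    have "\<forall>\<^sub>F u in at_right 0. \<phi> u < t" using D(4) t by (rule order_tendstoD)
    moreover have "\<forall>\<^sub>F u in at_right 0. u < a" using a by (intro eventually_at_rightI[of 0 a]) auto
    ultimately have "\<forall>\<^sub>F u in at_right 0. \<phi> u < t \<and> u < a \<and> 0 < u"
      using eventually_at_right_less[of 0] by eventually_elim auto
    then obtain u where u: "\<phi> u < t" "u < a" "0 < u"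
      using eventually_happens'[OF trivial_limit_at_right_real] by blast
    have "\<exists>x. u \<le> x \<and> x \<le> a \<and> \<phi> x = t"
      by (rule IVT') (use u ta in \<open>auto intro: continuous_on_subset[OF D(2)]\<close>)
    then show ?thesis using u by force
  qed
  have "0 < index_inv a \<phi> t \<and> index_inv a \<phi> t \<le> a \<and> (index_inv a \<phi> t < a \<longrightarrow> \<phi> (index_inv a \<phi> t) = t)"
  proof (cases "t \<le> \<phi> a")
    case True
    then have "t \<in> \<phi> ` {0<..a}" using surj by blast
    then have "the_inv_into {0<..a} \<phi> t \<in> {0<..a}" "\<phi> (the_inv_into {0<..a} \<phi> t) = t"
      using the_inv_into_into[OF inj _ subset_refl] f_the_inv_into_f[OF inj] by auto
    then show ?thesis using True t by (simp add: index_inv_def)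
  next
    case False
    then show ?thesis using t a by (simp add: index_inv_def)
  qed
  then show "0 < index_inv a \<phi> t" and "index_inv a \<phi> t \<le> a"
    and "index_inv a \<phi> t < a \<Longrightarrow> \<phi> (index_inv a \<phi> t) = t" by auto
qed

text \<open>A supporting line at \<open>K powr (2 * r)\<close>, read back through the substitution
  \<open>t powr (2 * r)\<close>. Positivity of its slope follows from
  \<open>0 < (\<psi> K)^2\<close>.\<close>

lemma psi_tangent:
  assumes \<psi>: "index_function a b \<psi>" and r: "0 < r" and K: "0 < K" "K < a"
    and cvx: "convex_on {0<..a powr (2 * r)} (\<lambda>t. (\<psi> (t powr (1 / (2 * r))))\<^sup>2)"
  obtains \<beta> where "0 < \<beta>" and "(\<psi> K)\<^sup>2 \<le> \<beta> * K powr (2 * r)"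
    and "\<And>t. 0 < t \<Longrightarrow> t \<le> a \<Longrightarrow> (\<psi> K)\<^sup>2 + \<beta> * (t powr (2 * r) - K powr (2 * r)) \<le> (\<psi> t)\<^sup>2"
proof -
  define f where "f t = (\<psi> (t powr (1 / (2 * r))))\<^sup>2" for t
  have f_powr: "f (t powr (2 * r)) = (\<psi> t)\<^sup>2" if "0 < t" for t
    using that r by (simp add: f_def powr_powr)
  have "filterlim (\<lambda>t. t powr (1 / (2 * r))) (at_right 0) (at_right 0)"
    unfolding filterlim_at using r powr_at_right_0[of "1 / (2 * r)"] eventually_at_right_less[of 0]
    by (auto elim!: eventually_mono)
  then have "((\<lambda>t. \<psi> (t powr (1 / (2 * r)))) \<longlongrightarrow> 0) (at_right 0)"
    by (rule filterlim_compose[OF index_functionD(4)[OF \<psi>]])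
  from tendsto_power[OF this, of 2] have lim: "(f \<longlongrightarrow> 0) (at_right 0)"
    by (simp add: f_def[abs_def])
  have "convex_on {0<..a powr (2 * r)} f" using cvx by (simp add: f_def[abs_def])
  moreover have "0 < K powr (2 * r)" "K powr (2 * r) < a powr (2 * r)"
    using K r by (auto intro: powr_less_mono2)
  ultimately obtain \<beta> where
    \<beta>: "\<And>t. 0 < t \<Longrightarrow> t \<le> a powr (2 * r) \<Longrightarrow> f (K powr (2 * r)) + \<beta> * (t - K powr (2 * r)) \<le> f t"
      "f (K powr (2 * r)) \<le> \<beta> * K powr (2 * r)"
    using supporting_line lim by blast
  have le: "(\<psi> K)\<^sup>2 \<le> \<beta> * K powr (2 * r)" using \<beta>(2) f_powr K by simp
  have "0 < (\<psi> K)\<^sup>2" using index_functionD(1)[OF \<psi>, of K] K by simp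
  then have "0 < \<beta>" using le by (smt (verit) mult_nonpos_nonneg powr_ge_zero)
  moreover have "(\<psi> K)\<^sup>2 + \<beta> * (t powr (2 * r) - K powr (2 * r)) \<le> (\<psi> t)\<^sup>2" if "0 < t" "t \<le> a" for t
    using \<beta>(1)[of "t powr (2 * r)"] f_powr that K r by (simp add: powr_mono2)
  ultimately show thesis using that le by blast
qed

text \<open>The scalar tangent inequality becomes one between quadratic forms by positivity of the
  calculus. As the coefficient of \<open>(norm u)^2\<close> is nonpositive, upper bounds on
  \<open>norm u\<close> can be inserted.\<close>

lemma psi_op_lower_bound:
  fixes G :: "'x::{real_inner,banach} \<Rightarrow>\<^sub>L 'x"
  assumes G: "positive_op G" and \<psi>: "index_function (norm G) b \<psi>"
    and r: "0 < r" and K: "0 < K" "K < norm G"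
    and cvx: "convex_on {0<..norm G powr (2 * r)} (\<lambda>t. (\<psi> (t powr (1 / (2 * r))))\<^sup>2)"
  obtains \<beta> where "0 < \<beta>" and "(\<psi> K)\<^sup>2 \<le> \<beta> * K powr (2 * r)"
    and "\<And>u. ((\<psi> K)\<^sup>2 - \<beta> * K powr (2 * r)) * (norm u)\<^sup>2 + \<beta> * (norm (op_power G r u))\<^sup>2
      \<le> (norm (op_fun \<psi> G u))\<^sup>2"
proof -
  obtain \<beta> where \<beta>: "0 < \<beta>" "(\<psi> K)\<^sup>2 \<le> \<beta> * K powr (2 * r)"
    "\<And>t. 0 < t \<Longrightarrow> t \<le> norm G \<Longrightarrow> (\<psi> K)\<^sup>2 + \<beta> * (t powr (2 * r) - K powr (2 * r)) \<le> (\<psi> t)\<^sup>2"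
    using psi_tangent[OF \<psi> r K cvx] by blast
  define k where "k = (\<psi> K)\<^sup>2 - \<beta> * K powr (2 * r)"
  have ext\<psi>: "extendable (norm G) \<psi>" by (rule extendable_index_function[OF \<psi>])
  have extr: "extendable (norm G) (\<lambda>t. t powr r)" using r by (intro extendable_powr) simp
  have ext: "extendable (norm G) (\<lambda>t. (\<psi> t)\<^sup>2)" "extendable (norm G) (\<lambda>t. (t powr r)\<^sup>2)"
    unfolding power2_eq_square by (intro extendable_mult ext\<psi> extr)+
  have "k * (norm u)\<^sup>2 + \<beta> * (norm (op_power G r u))\<^sup>2 \<le> (norm (op_fun \<psi> G u))\<^sup>2" for u
  proof -
    have "0 \<le> op_fun (\<lambda>t. (\<psi> t)\<^sup>2 - (k + \<beta> * (t powr r)\<^sup>2)) G u \<bullet> u"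
    proof (rule op_fun_nonneg[OF G])
      show "extendable (norm G) (\<lambda>t. (\<psi> t)\<^sup>2 - (k + \<beta> * (t powr r)\<^sup>2))"
        by (intro extendable_diff extendable_add extendable_const extendable_cmult ext)
      show "0 \<le> (\<psi> t)\<^sup>2 - (k + \<beta> * (t powr r)\<^sup>2)" if "0 < t" "t \<le> norm G" for t
      proof -
        have "(t powr r)\<^sup>2 = t powr (2 * r)" by (simp add: power2_eq_square flip: powr_add)
        then show ?thesis using \<beta>(3)[OF that] by (simp add: k_def algebra_simps)
      qed
    qed
    also have "op_fun (\<lambda>t. (\<psi> t)\<^sup>2 - (k + \<beta> * (t powr r)\<^sup>2)) G =
        op_fun (\<lambda>t. (\<psi> t)\<^sup>2) G - (k *\<^sub>R id_blinfun + \<beta> *\<^sub>R op_fun (\<lambda>t. (t powr r)\<^sup>2) G)"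
      by (simp add: op_fun_diff[OF G] op_fun_add[OF G] op_fun_cmult[OF G] op_fun_const[OF G]
          extendable_add extendable_const extendable_cmult ext)
    finally show ?thesis
      unfolding op_power_def norm_op_fun_square[OF G ext\<psi>] norm_op_fun_square[OF G extr]
      by (simp add: blinfun.bilinear_simps inner_diff_left inner_add_left power2_norm_eq_inner)
  qed
  then show thesis using that[OF \<beta>(1,2)] unfolding k_def by blast
qed

text \<open>The tangent with exponent \<open>p - s\<close> is applied to \<open>w\<close> and bounds
  \<open>h\<close>; the one with exponent \<open>s\<close> is then applied to \<open>h\<close>. If
  the inverse is capped, plain operator norm bounds suffice.\<close>

lemma interpolation_bound:
  fixes G :: "'x::{real_inner,banach} \<Rightarrow>\<^sub>L 'x"
  assumes G: "positive_op G" and \<rho>: "index_function (norm G) (\<rho> (norm G)) \<rho>"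
    and s: "0 \<le> s" "s \<le> p" and E: "0 < E" and \<Delta>: "0 < \<Delta>"
    and cvx_p: "s < p \<Longrightarrow> convex_on {0<..norm G powr (2 * (p - s))}
      (\<lambda>t. (psi \<rho> s (t powr (1 / (2 * (p - s)))))\<^sup>2)"
    and cvx_s: "0 < s \<Longrightarrow> convex_on {0<..norm G powr (2 * s)}
      (\<lambda>t. (psi \<rho> s (t powr (1 / (2 * s))))\<^sup>2)"
    and hw: "(norm h)\<^sup>2 \<le> E * norm (op_power G (p - s) w)" "norm w \<le> norm h"
    and \<Delta>w: "norm (op_fun (psi \<rho> s) G w) \<le> \<Delta>" and \<Delta>h: "norm (op_fun (psi \<rho> s) G h) \<le> \<Delta>"
  shows "norm (op_power G s h) \<le> E * index_inv (norm G) (psi \<rho> p) (\<Delta> / E) powr p"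
proof -
  define a where "a = norm G"
  define K where "K = index_inv a (psi \<rho> p) (\<Delta> / E)"
  define r where "r = p - s"
  have r: "0 \<le> r" using s by (simp add: r_def)
  have a: "0 < a" using positive_opD(3)[OF G] by (simp add: a_def)
  have ind: "index_function a (psi \<rho> q a) (psi \<rho> q)" if "0 \<le> q" for q
    using psi_index_function[of a _ \<rho> q] \<rho> a that by (simp add: a_def)
  have "0 \<le> p" "0 < \<Delta> / E" using s E \<Delta> by auto
  note K = index_inv_cases[OF ind[OF \<open>0 \<le> p\<close>] a \<open>0 < \<Delta> / E\<close>, folded K_def]
  have powr_sq: "(K powr q)\<^sup>2 = K powr (2 * q)" for q
    by (simp add: power2_eq_square flip: powr_add)
  have "0 < psi \<rho> s K" using index_functionD(1)[OF ind[OF s(1)], of K] K by simp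
  \<comment> \<open>Below the cap, \<open>K\<close> satisfies
    \<open>E * K powr r * psi \<rho> s K = \<Delta>\<close>, because \<open>psi \<rho> p\<close> is
    \<open>t powr r\<close> times \<open>psi \<rho> s\<close>.\<close>
  have \<Delta>_eq: "\<Delta>\<^sup>2 = E\<^sup>2 * K powr (2 * r) * (psi \<rho> s K)\<^sup>2" if "K < a"
  proof -
    have "K powr r * psi \<rho> s K = psi \<rho> p K"
      by (simp add: psi_def r_def flip: powr_add mult.assoc)
    then have "\<Delta> = E * (K powr r * psi \<rho> s K)" using K(3)[OF that] E by simp
    then show ?thesis by (simp add: power_mult_distrib powr_sq)
  qed
  have step1: "norm h \<le> E * K powr r"
  proof (rule ccontr)
    assume neg: "\<not> norm h \<le> E * K powr r"
    have "0 \<le> E * K powr r" using E by simp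
    then have h0: "0 < norm h" using neg by linarith
    \<comment> \<open>This crude bound settles the cases \<open>r = 0\<close> and
      \<open>K = a\<close>, so a tangent at an interior point is available.\<close>
    have "norm (op_power G r w) \<le> a powr r * norm w"
      unfolding a_def by (rule norm_op_power_le[OF G r])
    also have "\<dots> \<le> a powr r * norm h" by (intro mult_left_mono hw) simp
    finally have "E * norm (op_power G r w) \<le> E * (a powr r * norm h)"
      using E by (intro mult_left_mono) simp_all
    then have "(norm h)\<^sup>2 \<le> E * (a powr r * norm h)" using hw(1)[folded r_def] by linarith
    then have "norm h * norm h \<le> (E * a powr r) * norm h" by (simp add: power2_eq_square mult_ac)
    then have ha: "norm h \<le> E * a powr r" using h0 by simp
    have "r \<noteq> 0"
    proof
      assume "r = 0"
      then show False using ha neg a K(1) by simp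
    qed
    then have r0: "0 < r" and "s < p" using r by (simp_all add: r_def)
    have "K \<noteq> a" using ha neg by auto
    then have Ka: "K < a" using K(2) by simp
    define k where "k = (psi \<rho> s K)\<^sup>2"
    obtain \<beta> where \<beta>: "0 < \<beta>" "k \<le> \<beta> * K powr (2 * r)"
      "\<And>u. (k - \<beta> * K powr (2 * r)) * (norm u)\<^sup>2 + \<beta> * (norm (op_power G r u))\<^sup>2
        \<le> (norm (op_fun (psi \<rho> s) G u))\<^sup>2"
      unfolding k_def
      by (rule psi_op_lower_bound[OF G ind[OF s(1), unfolded a_def] r0 K(1) Ka[unfolded a_def]
            cvx_p[folded r_def, OF \<open>s < p\<close>]]) (rule that, unfold k_def)
    define x where "x = (norm h)\<^sup>2"
    have "(E * K powr r)\<^sup>2 < x"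
      unfolding x_def using neg E by (intro power_strict_mono) auto
    then have x: "E\<^sup>2 * K powr (2 * r) < x" by (simp add: power_mult_distrib powr_sq)
    have x0: "0 < x" using h0 by (simp add: x_def)
    \<comment> \<open>Inserting \<open>norm (op_power G r w) \<ge> x / E\<close> and
      \<open>(norm w)^2 \<le> x\<close> into the tangent inequality yields a quantity that exceeds
      \<Delta> squared as soon as \<open>x > E^2 * K powr (2 * r)\<close>.\<close>
    have "x / E \<le> norm (op_power G r w)" using hw(1) E by (simp add: x_def r_def field_simps)
    then have "(x / E)\<^sup>2 \<le> (norm (op_power G r w))\<^sup>2" using x0 E by (intro power_mono) auto
    then have "\<beta> * (x / E)\<^sup>2 \<le> \<beta> * (norm (op_power G r w))\<^sup>2" using \<beta>(1) by simp
    moreover have "(norm w)\<^sup>2 \<le> x" using hw(2) by (simp add: x_def power_mono)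
    then have "(k - \<beta> * K powr (2 * r)) * x \<le> (k - \<beta> * K powr (2 * r)) * (norm w)\<^sup>2"
      using \<beta>(2) by (intro mult_left_mono_neg) auto
    moreover have "(norm (op_fun (psi \<rho> s) G w))\<^sup>2 \<le> \<Delta>\<^sup>2" using \<Delta>w by (simp add: power_mono)
    ultimately have "(k - \<beta> * K powr (2 * r)) * x + \<beta> * (x / E)\<^sup>2 \<le> \<Delta>\<^sup>2" using \<beta>(3)[of w] by linarith
    then have upper: "x * k + \<beta> * x * (x / E\<^sup>2 - K powr (2 * r)) \<le> E\<^sup>2 * K powr (2 * r) * k"
      unfolding \<Delta>_eq[OF Ka] k_def[symmetric] by (simp add: algebra_simps power2_eq_square)
    have "0 < x / E\<^sup>2 - K powr (2 * r)" using x E by (simp add: field_simps)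
    then have "0 < \<beta> * x * (x / E\<^sup>2 - K powr (2 * r))" using \<beta>(1) x0 by simp
    moreover have "E\<^sup>2 * K powr (2 * r) * k \<le> x * k"
      using x by (intro mult_right_mono) (auto simp: k_def)
    ultimately show False using upper by linarith
  qed
  have "norm (op_power G s h) \<le> E * K powr p"
  proof -
    have p: "K powr p = K powr s * K powr r" by (simp add: r_def flip: powr_add)
    have "s = 0 \<or> K = a \<or> 0 < s \<and> K < a" using s(1) K(2) by auto
    then consider "s = 0" | "K = a" | "0 < s" "K < a" by blast
    then show ?thesis
    proof cases
      case 1
      have "K powr p = K powr r" using 1 by (simp add: r_def)
      then show ?thesis using step1 unfolding 1 op_power_0[OF G] by simp
    next
      case 2
      have "norm (op_power G s h) \<le> a powr s * norm h"
        unfolding a_def by (rule norm_op_power_le[OF G s(1)])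
      also have "\<dots> \<le> a powr s * (E * K powr r)" by (intro mult_left_mono step1) simp
      also have "\<dots> = E * (K powr s * K powr r)" unfolding 2 by (rule mult.left_commute)
      finally show ?thesis unfolding p .
    next
      case 3
      define k where "k = (psi \<rho> s K)\<^sup>2"
      obtain \<beta> where \<beta>: "0 < \<beta>" "k \<le> \<beta> * K powr (2 * s)"
        "\<And>u. (k - \<beta> * K powr (2 * s)) * (norm u)\<^sup>2 + \<beta> * (norm (op_power G s u))\<^sup>2
          \<le> (norm (op_fun (psi \<rho> s) G u))\<^sup>2"
        unfolding k_def
        by (rule psi_op_lower_bound[OF G ind[OF s(1), unfolded a_def] 3(1) K(1)
              3(2)[unfolded a_def] cvx_s[OF 3(1)]]) (rule that, unfold k_def)
      \<comment> \<open>\<open>H\<close> is the square of the bound from \<open>step1\<close>, and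
        \<Delta> squared equals \<open>H * k\<close>; the terms \<open>H * k\<close> cancel and only
        \<beta> remains to be divided out.\<close>
      define H where "H = E\<^sup>2 * K powr (2 * r)"
      have "(norm h)\<^sup>2 \<le> (E * K powr r)\<^sup>2" using step1 by (simp add: power_mono)
      then have "(norm h)\<^sup>2 \<le> H" by (simp add: H_def power_mult_distrib powr_sq)
      then have "(k - \<beta> * K powr (2 * s)) * H \<le> (k - \<beta> * K powr (2 * s)) * (norm h)\<^sup>2"
        using \<beta>(2) by (intro mult_left_mono_neg) auto
      moreover have "(norm (op_fun (psi \<rho> s) G h))\<^sup>2 \<le> \<Delta>\<^sup>2" by (rule power_mono[OF \<Delta>h]) simp
      then have "(norm (op_fun (psi \<rho> s) G h))\<^sup>2 \<le> H * k"
        unfolding \<Delta>_eq[OF 3(2)] H_def k_def .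
      moreover have "(k - \<beta> * K powr (2 * s)) * H = H * k - \<beta> * (K powr (2 * s) * H)"
        by (simp add: algebra_simps)
      ultimately have "\<beta> * (norm (op_power G s h))\<^sup>2 \<le> \<beta> * (K powr (2 * s) * H)"
        using \<beta>(3)[of h] by linarith
      then have "(norm (op_power G s h))\<^sup>2 \<le> K powr (2 * s) * H" using \<beta>(1) by simp
      also have "\<dots> = (E * K powr p)\<^sup>2"
        unfolding H_def p power_mult_distrib powr_sq by (simp only: mult_ac)
      finally have "(norm (op_power G s h))\<^sup>2 \<le> (E * K powr p)\<^sup>2" .
      then show ?thesis by (rule power2_le_imp_le) (use E in simp)
    qed
  qed
  then show ?thesis unfolding K_def a_def .
qed

section \<open>Error estimate under the discrepancy principle\<close>

theorem theorem4p8: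
  fixes A :: "'x::{real_inner,banach} \<Rightarrow>\<^sub>L 'y::{real_inner,banach}"
    and B :: "'x \<Rightarrow> 'x" and D :: "'x set" and G :: "'x \<Rightarrow>\<^sub>L 'x"
    and \<rho> :: "real \<Rightarrow> real" and \<alpha> :: "nat \<Rightarrow> real" and n :: nat
    and x\<^sub>0 xd v :: 'x and y y\<^sub>\<delta> :: 'y
    and a \<delta> C\<^sub>1 C\<^sub>2 m p E s :: real
  assumes "inj (blinfun_apply A)" and "\<not> closed (range (blinfun_apply A))"
    and "A xd = y" and "norm (y - y\<^sub>\<delta>) \<le> \<delta>"
    and "linear_operator_on D B" and "densely_defined D" and "unbounded_on D B"
    and "self_adjoint_on D B" and "strictly_positive_on D B"
    and "blinfun_apply G = the_inv_into D B" and "a = norm G"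
    and "index_function a (\<rho> a) \<rho>"
    and "n \<ge> 1" and "\<forall>k\<in>{1..n}. \<alpha> k > 0"
    and "1 \<le> C\<^sub>1" and "C\<^sub>1 \<le> C\<^sub>2"
    and "C\<^sub>1 * \<delta> \<le> norm (A (iterate A G s \<alpha> x\<^sub>0 y\<^sub>\<delta> n) - y\<^sub>\<delta>)"
    and "norm (A (iterate A G s \<alpha> x\<^sub>0 y\<^sub>\<delta> n) - y\<^sub>\<delta>) \<le> C\<^sub>2 * \<delta>"
    and "m > 0" and "\<forall>x. m * norm (op_fun \<rho> G x) \<le> norm (A x)"
    and "p > 0" and "E > 0"
    and "xd - x\<^sub>0 = op_power G p v" and "norm v \<le> E"
    and "0 \<le> s" and "s \<le> p"
    and "s < p \<Longrightarrow>
      convex_on {0<..a powr (2 * p - 2 * s)} (\<lambda>t. (psi \<rho> s (t powr (1 / (2 * p - 2 * s))))\<^sup>2)"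
    and "0 < s \<Longrightarrow>
      convex_on {0<..a powr (2 * s)} (\<lambda>t. (psi \<rho> s (t powr (1 / (2 * s))))\<^sup>2)"
  shows "norm (iterate A G s \<alpha> x\<^sub>0 y\<^sub>\<delta> n - xd)
    \<le> E * index_inv a (psi \<rho> p) ((C\<^sub>2 + 1) * \<delta> / (m * E)) powr p"
proof -
  note A_inj = assms(1) and y = assms(3) and noise = assms(4) and B = assms(5-9)
    and G_def = assms(10) and a_def = assms(11) and \<rho> = assms(12) and n = assms(13)
    and \<alpha> = assms(14) and C\<^sub>1 = assms(15) and lower = assms(17) and upper = assms(18)
    and m = assms(19) and link = assms(20) and p = assms(21) and E = assms(22)
    and source = assms(23) and v = assms(24) and s = assms(25,26) and cvx = assms(27,28)
  note G = positive_op_inverse(1)[OF B G_def] and G_inj = positive_op_inverse(2)[OF B G_def]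
  have a0: "0 < a" using positive_opD(3)[OF G] by (simp add: a_def)
  have A0: "A x = 0 \<Longrightarrow> x = 0" for x using injD[OF A_inj, of x 0] by (simp add: blinfun.zero_right)
  define T where "T = A o\<^sub>L op_power G s"
  define yd where "yd = y\<^sub>\<delta> - A x\<^sub>0"
  define zn where "zn = op_fun (g_filter \<alpha> n) (adj T o\<^sub>L T) (adj T yd)"
  define z where "z = op_power G (p - s) v"
  define h where "h = zn - z"
  define xn where "xn = iterate A G s \<alpha> x\<^sub>0 y\<^sub>\<delta> n"
  have xn: "xn = x\<^sub>0 + op_power G s zn" by (simp add: xn_def iterate_def Let_def zn_def T_def yd_def)
  have xd: "xd = x\<^sub>0 + op_power G s z"
    using op_power_add[OF G s(1), of "p - s"] s source by (simp add: z_def algebra_simps)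
  have err: "xn - xd = op_power G s h" by (simp add: xn xd h_def blinfun.diff_right)
  \<comment> \<open>\<open>A\<close> and \<open>G\<close> to the power \<open>s\<close> are
    injective, so \<open>T = 0\<close> would make the space trivial and contradict
    \<open>0 < a\<close>.\<close>
  have "T \<noteq> 0"
  proof
    assume "T = 0"
    then have "T x = 0" for x by simp
    then have "x = 0" for x :: 'x
      using A0 op_power_eq_0_imp[OF G G_inj s(1), of x] by (simp add: T_def)
    from this[of "G _"] have "G = 0" by (intro blinfun_eqI) simp
    then show False using a0 a_def by simp
  qed
  have res: "norm (yd - T zn) = norm (A xn - y\<^sub>\<delta>)"
    unfolding xn yd_def T_def by (simp add: blinfun.add_right norm_minus_commute algebra_simps)
  have "yd - T z = y\<^sub>\<delta> - y" unfolding yd_def T_def y[symmetric] xd by (simp add: blinfun.add_right)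
  then have data: "norm (yd - T z) \<le> \<delta>" using noise by (simp add: norm_minus_commute)
  then have \<delta>: "0 \<le> \<delta>" by (meson norm_ge_zero order_trans)
  \<comment> \<open>With \<open>1 \<le> C\<^sub>1\<close> the data error is at most the residual, as
    \<open>discrepancy_estimate\<close> requires.\<close>
  then have "1 * \<delta> \<le> C\<^sub>1 * \<delta>" using C\<^sub>1 by (intro mult_right_mono)
  then have "norm (yd - T z) \<le> norm (yd - T zn)" using data lower res by (simp add: xn_def)
  then obtain w where w: "(norm h)\<^sup>2 \<le> z \<bullet> w" "norm w \<le> norm h" "norm (T w) \<le> norm (T h)"
    using discrepancy_estimate[OF \<open>T \<noteq> 0\<close> \<alpha>[rule_format] n zn_def] unfolding h_def by blast
  have Th_eq: "T h = (yd - T z) - (yd - T zn)" by (simp add: h_def blinfun.diff_right)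
  have "norm (T h) \<le> norm (yd - T z) + norm (yd - T zn)"
    unfolding Th_eq by (rule norm_triangle_ineq4)
  also have "\<dots> \<le> (C\<^sub>2 + 1) * \<delta>" using data upper res by (simp add: xn_def algebra_simps)
  finally have Th: "norm (T h) \<le> (C\<^sub>2 + 1) * \<delta>" .
  show ?thesis
  proof (cases "\<delta> = 0")
    \<comment> \<open>Here the right-hand side is 0, since \<open>index_inv\<close> is 0 at 0 and
      \<open>0 powr p = 0\<close>; exact recovery follows from injectivity of
      \<open>A\<close>.\<close>
    case True
    then have "A (op_power G s h) = 0" using Th by (simp add: T_def)
    then have "op_power G s h = 0" by (rule A0)
    then have "xn = xd" using err by simp
    then show ?thesis using True by (simp add: xn_def index_inv_def)
  next
    case False
    define \<Delta> where "\<Delta> = (C\<^sub>2 + 1) * \<delta> / m"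
    have "0 < \<delta>" using \<delta> False by simp
    then have \<Delta>: "0 < \<Delta>" using assms(15,16) m by (simp add: \<Delta>_def)
    have psi_le: "norm (op_fun (psi \<rho> s) G u) \<le> \<Delta>" if u: "norm (T u) \<le> norm (T h)" for u
    proof -
      \<comment> \<open>Factoring out the power \<open>s\<close> lets the link condition be applied
        at \<open>op_power G s u\<close>, where its right-hand side is
        \<open>norm (T u)\<close>.\<close>
      have "op_fun (psi \<rho> s) G = op_fun (\<lambda>t. \<rho> t * t powr s) G"
        by (rule op_fun_cong) (simp add: psi_def)
      also have "\<dots> = op_fun \<rho> G o\<^sub>L op_power G s"
        unfolding op_power_def
        by (intro op_fun_mult[OF G] extendable_powr s(1) extendable_index_function[OF \<rho>[unfolded a_def]])
      finally have "m * norm (op_fun (psi \<rho> s) G u) \<le> norm (T u)" using link by (simp add: T_def)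
      then show ?thesis using u Th m by (simp add: \<Delta>_def field_simps)
    qed
    \<comment> \<open>The source condition enters here: the power \<open>p - s\<close> is moved from
      \<open>v\<close> onto \<open>w\<close>.\<close>
    have "z \<bullet> w = v \<bullet> op_power G (p - s) w"
      unfolding z_def op_power_def by (intro op_fun_selfadjoint[OF G] extendable_powr) (use s in simp)
    also have "\<dots> \<le> norm v * norm (op_power G (p - s) w)" by (rule norm_cauchy_schwarz)
    also have "\<dots> \<le> E * norm (op_power G (p - s) w)" using v by (intro mult_right_mono) simp_all
    finally have hw: "(norm h)\<^sup>2 \<le> E * norm (op_power G (p - s) w)" using w(1) by linarith
    have two: "2 * (p - s) = 2 * p - 2 * s" by simp
    have "norm (op_power G s h) \<le> E * index_inv a (psi \<rho> p) (\<Delta> / E) powr p"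
      unfolding a_def
    proof (rule interpolation_bound[OF G \<rho>[unfolded a_def] s E \<Delta> _ _ hw w(2)])
      show "norm (op_fun (psi \<rho> s) G w) \<le> \<Delta>" using w(3) by (rule psi_le)
      show "norm (op_fun (psi \<rho> s) G h) \<le> \<Delta>" by (rule psi_le) simp
    qed (use cvx in \<open>simp_all only: a_def two\<close>)
    then show ?thesis unfolding err[unfolded xn_def] by (simp add: \<Delta>_def)
  qed
qed

end
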